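(* Let $A$ be a fixed $s \times t$ binary matrix. There exists a polynomial $p$ (depending only on $A$) such that for every $\epsilon > 0$ the following holds with $\delta = 1/p(\epsilon^{-1})$: if an $n \times n$ binary matrix $M$ contains $\epsilon n^2$ pairwise-disjoint copies of $A$, then the total number of copies of $A$ in $M$ is at least $\delta n^{s+t}$.
   Context: An $m\times n$ matrix over an alphabet $\Gamma$ is a function $M:[m]\times[n]\to\Gamma$; binary means $\Gamma=\{0,1\}$. A submatrix of $M$ is obtained by deleting some rows and columns while preserving the row and column order: for row indices $r_1<\dots<r_s$ and column indices $c_1<\dots<c_t$, the submatrix on $\{r_1,\dots,r_s\}\times\{c_1,\dots,c_t\}$ has $(i,j)$ entry $M(r_i,c_j)$. A copy of $A$ in $M$ is an $s\times t$ submatrix of $M$ equal to $A$. A set of copies is pairwise disjoint if every entry (position) of $M$ is contained in at most one of the copies. *)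

theory Defs
  imports "HOL-Computational_Algebra.Polynomial"
begin

text \<open>A binary matrix is modelled as a Boolean-valued function of (0-based) row and
column indices; only indices inside the stated dimensions matter.
A copy of the s x t matrix A in the n x n matrix M is given by its row set R and
column set C (subsets of {0..<n} of sizes s and t); the i-th smallest row of R and
the j-th smallest column of C carry entry A i j.\<close>

definition is_copy ::
  "nat \<Rightarrow> nat \<Rightarrow> (nat \<Rightarrow> nat \<Rightarrow> bool) \<Rightarrow> nat \<Rightarrow> (nat \<Rightarrow> nat \<Rightarrow> bool)
     \<Rightarrow> nat set \<times> nat set \<Rightarrow> bool" where
  "is_copy s t A n M RC \<longleftrightarrow>
     (case RC of (R, C) \<Rightarrow>
        R \<subseteq> {..<n} \<and> C \<subseteq> {..<n} \<and> card R = s \<and> card C = t \<and>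
        (\<forall>i<s. \<forall>j<t. M (sorted_list_of_set R ! i) (sorted_list_of_set C ! j) = A i j))"

definition copies ::
  "nat \<Rightarrow> nat \<Rightarrow> (nat \<Rightarrow> nat \<Rightarrow> bool) \<Rightarrow> nat \<Rightarrow> (nat \<Rightarrow> nat \<Rightarrow> bool)
     \<Rightarrow> (nat set \<times> nat set) set" where
  "copies s t A n M = {RC. is_copy s t A n M RC}"

definition positions :: "nat set \<times> nat set \<Rightarrow> (nat \<times> nat) set" where
  "positions RC = fst RC \<times> snd RC"

definition pairwise_disjoint_copies :: "(nat set \<times> nat set) set \<Rightarrow> bool" where
  "pairwise_disjoint_copies S \<longleftrightarrow>
     (\<forall>X\<in>S. \<forall>Y\<in>S. X \<noteq> Y \<longrightarrow> positions X \<inter> positions Y = {})"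

end

theory Submission
  imports Defs "HOL-Library.FuncSet"
begin

text \<open>Sample polynomially many random columns and classify the rows by their traces on the sample. If
  for many samples the rare traces carry many rows, the Sauer-Shelah lemma finds shattered columns among
  few rows and columns, and these contain a copy of A in every row order, which already gives
  polynomially many copies. Otherwise all but few rows are close to one of polynomially many
  representative rows. The same holds for columns, so up to few bad entries M only depends on a label
  of the row and a label of the column, with polynomially many labels.

  For the order, cut the rows into nested cells of equal label: each level cuts after the initial
  1/h-fraction of every cell of the previous level. Delete these initial segments, the small cells and
  the entries lying in blocks of initial segments with many bad entries. The loss is controlled by
  h and the number of bad entries alone, not by the number of labels, so one of the disjoint copies survives.
  Replacing its i-th row by the initial segment of its cell of level i, and similarly for columns,
  gives ordered sets of rows and columns of polynomial density, most of whose transversals are copies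
  of A.\<close>

section \<open>Ranks and tuples\<close>

text \<open>The number of labels is polynomial in the demanded accuracy, so an accuracy depending on
  the number of labels or cells would be circular. The parameters are therefore fixed in the order w
  (at least 1/\<epsilon>), h (a multiple of w), W (a multiple of h^2 w, for the bad entries), T
  (polynomial in W, for the labels), Q (polynomial in T, for the cells); T and Q enter only the
  final density. This works because a product of two cells is at most h^2 times as large as the
  product of their initial segments: if the latter has too many bad entries, these entries pay for
  the whole product.

  Replacing rows by their whole label classes would fail: classes interleave, and several rows of
  one copy may carry the same label. Deleting the initial segments forces each surviving row to lie
  to the right of the segment that replaces it, which leaves room for the segments of the later
  rows.

  Probabilities appear as counts of tuples, in inequalities of natural numbers with denominators
  cleared.\<close>

definition rank :: "nat set \<Rightarrow> nat \<Rightarrow> nat" where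
  "rank K x = card {y \<in> K. y < x}"

lemma rank_less_card: "finite K \<Longrightarrow> x \<in> K \<Longrightarrow> rank K x < card K"
  unfolding rank_def by (rule psubset_card_mono) auto

lemma rank_strict_mono:
  assumes "finite K" "x \<in> K" "x < y"
  shows "rank K x < rank K y"
  unfolding rank_def using assms by (intro psubset_card_mono) auto

lemma inj_on_rank: "finite K \<Longrightarrow> inj_on (rank K) K"
  by (metis (no_types, lifting) inj_onI nat_neq_iff rank_strict_mono)

lemma bij_betw_rank: "finite K \<Longrightarrow> bij_betw (rank K) K {..<card K}"
  unfolding bij_betw_def
  by (intro conjI inj_on_rank card_subset_eq) (auto simp: inj_on_rank rank_less_card card_image)

lemma rank_nth_sorted_list_of_set:
  assumes "finite K" "i < card K"
  shows "rank K (sorted_list_of_set K ! i) = i"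
proof -
  define l where "l = sorted_list_of_set K"
  have l: "sorted_wrt (<) l" "set l = K" "length l = card K" "distinct l"
    using assms by (auto simp: l_def)
  have "{y \<in> K. y < l ! i} = (!) l ` {..<i}"
  proof (intro equalityI subsetI)
    fix y assume "y \<in> {y \<in> K. y < l ! i}"
    then obtain j where j: "j < card K" "y = l ! j" "l ! j < l ! i"
      using l by (auto simp: in_set_conv_nth)
    have "j < i"
    proof (rule ccontr)
      assume "\<not> j < i"
      then have "l ! i \<le> l ! j"
        using l j sorted_wrt_nth_less[OF l(1), of i j] by (cases "i = j") auto
      then show False using j by simp
    qed
    then show "y \<in> (!) l ` {..<i}" using j by auto
  next
    fix y assume "y \<in> (!) l ` {..<i}"
    then obtain j where j: "j < i" "y = l ! j" by auto
    then have "l ! j \<in> set l" using l assms by (intro nth_mem) simp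
    then show "y \<in> {y \<in> K. y < l ! i}"
      using l assms j sorted_wrt_nth_less[OF l(1), of j i] by auto
  qed
  moreover have "inj_on ((!) l) {..<i}"
    using l assms by (auto simp: inj_on_def nth_eq_iff_index_eq)
  ultimately show ?thesis
    unfolding rank_def l_def[symmetric] by (simp add: card_image)
qed

text \<open>Ranks replace positions in sorted lists: a copy can then be verified point by point on
  sets given as images of tuples, whatever their order, and rows and columns play symmetric roles,
  which makes transposition immediate.\<close>

lemma is_copy_iff_rank:
  "is_copy s t A n M (R, C) \<longleftrightarrow>
     R \<subseteq> {..<n} \<and> C \<subseteq> {..<n} \<and> card R = s \<and> card C = t \<and>
     (\<forall>r\<in>R. \<forall>c\<in>C. M r c = A (rank R r) (rank C c))"
proof (cases "R \<subseteq> {..<n} \<and> C \<subseteq> {..<n} \<and> card R = s \<and> card C = t")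
  case True
  then have fin: "finite R" "finite C" by (auto intro: finite_subset)
  have nth: "(\<forall>x\<in>K. P x) \<longleftrightarrow> (\<forall>i<card K. P (sorted_list_of_set K ! i))"
    if "finite K" for K :: "nat set" and P
    using that all_set_conv_all_nth[of "sorted_list_of_set K" P] by simp
  have "(\<forall>r\<in>R. \<forall>c\<in>C. M r c = A (rank R r) (rank C c)) \<longleftrightarrow>
      (\<forall>i<s. \<forall>j<t. M (sorted_list_of_set R ! i) (sorted_list_of_set C ! j) = A i j)"
    using True fin by (simp add: nth rank_nth_sorted_list_of_set)
  then show ?thesis using True unfolding is_copy_def by auto
qed (auto simp: is_copy_def)

lemma finite_copies: "finite (copies s t A n M)"
  by (rule finite_subset[of _ "Pow {..<n} \<times> Pow {..<n}"]) (auto simp: copies_def is_copy_def)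

section \<open>Counting tuples with prescribed, equal or distinct values\<close>

lemma card_tuples_covering_le:
  fixes I :: "'i set" and X :: "'a set"
  assumes "finite I" "finite X" "finite C"
  shows "card {y \<in> I \<rightarrow>\<^sub>E X. C \<subseteq> y ` I} * card X ^ card C \<le> card I ^ card C * card X ^ card I"
proof -
  \<comment> \<open>Choosing for every element of C a coordinate where it occurs and overwriting these coordinates
    by an arbitrary tuple over X is injective.\<close>
  define Y where "Y = {y \<in> I \<rightarrow>\<^sub>E X. C \<subseteq> y ` I}"
  define g where "g y = restrict (\<lambda>c. SOME i. i \<in> I \<and> y i = c) C" for y :: "'i \<Rightarrow> 'a"
  have g: "g y c \<in> I \<and> y (g y c) = c" if "y \<in> Y" "c \<in> C" for y c
  proof -
    have "\<exists>i. i \<in> I \<and> y i = c" using that by (auto simp: Y_def)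
    from someI_ex[OF this] show ?thesis using that by (simp add: g_def)
  qed
  define h where "h = (\<lambda>(y, z). (g y, \<lambda>i. if i \<in> g y ` C then z (y i) else y i))"
  have "inj_on h (Y \<times> (C \<rightarrow>\<^sub>E X))"
  proof (rule inj_onI)
    fix p q assume pq: "p \<in> Y \<times> (C \<rightarrow>\<^sub>E X)" "q \<in> Y \<times> (C \<rightarrow>\<^sub>E X)" "h p = h q"
    obtain y z u v where yz: "p = (y, z)" "q = (u, v)" by (metis surj_pair)
    have mem: "y \<in> Y" "u \<in> Y" "z \<in> C \<rightarrow>\<^sub>E X" "v \<in> C \<rightarrow>\<^sub>E X" using pq yz by auto
    have gg: "g y = g u" using pq(3) unfolding yz h_def by simp
    have "(\<lambda>i. if i \<in> g y ` C then z (y i) else y i) = (\<lambda>i. if i \<in> g u ` C then v (u i) else u i)"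
      using pq(3) unfolding yz h_def prod.case prod.inject by blast
    then have e: "(if i \<in> g y ` C then z (y i) else y i) = (if i \<in> g u ` C then v (u i) else u i)" for i
      by (rule fun_cong)
    have zv: "z c = v c" if "c \<in> C" for c
      using e[of "g y c"] g[OF mem(1) that] g[OF mem(2) that] gg that by auto
    have "z = v" using zv mem by (auto intro: PiE_ext)
    moreover have "y i = u i" for i
    proof (cases "i \<in> g y ` C")
      case True
      then show ?thesis using g[OF mem(1)] g[OF mem(2)] gg by (auto)
    next
      case False
      then show ?thesis using e[of i] gg by simp
    qed
    ultimately show "p = q" using yz by auto
  qed
  moreover have "h ` (Y \<times> (C \<rightarrow>\<^sub>E X)) \<subseteq> (C \<rightarrow>\<^sub>E I) \<times> (I \<rightarrow>\<^sub>E X)"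
  proof
    fix p assume "p \<in> h ` (Y \<times> (C \<rightarrow>\<^sub>E X))"
    then obtain y z where yz: "y \<in> Y" "z \<in> C \<rightarrow>\<^sub>E X" "p = h (y, z)" by auto
    have "g y \<in> C \<rightarrow>\<^sub>E I" using g[OF yz(1)] by (auto simp: g_def)
    moreover have "(\<lambda>i. if i \<in> g y ` C then z (y i) else y i) \<in> I \<rightarrow>\<^sub>E X"
      using yz g[OF yz(1)] by (auto simp: Y_def PiE_iff extensional_def)
    ultimately show "p \<in> (C \<rightarrow>\<^sub>E I) \<times> (I \<rightarrow>\<^sub>E X)" using yz by (simp add: h_def)
  qed
  ultimately have "card (Y \<times> (C \<rightarrow>\<^sub>E X)) \<le> card ((C \<rightarrow>\<^sub>E I) \<times> (I \<rightarrow>\<^sub>E X))"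
    by (rule card_inj_on_le) (use assms in \<open>auto intro: finite_PiE\<close>)
  then show ?thesis
    using assms by (simp add: card_cartesian_product card_PiE Y_def)
qed

text \<open>Once all coordinates other than \<open>j\<close> are chosen, \<open>\<tau> (x i)\<close>
  is fixed and leaves at most \<open>b\<close> candidates for \<open>x j\<close>.\<close>

lemma card_tuples_same_value_le:
  assumes "finite I" "finite X" "i \<in> I" "j \<in> I" "i \<noteq> j"
    and b: "\<And>x. x \<in> X \<Longrightarrow> card {x' \<in> X. \<tau> x' = \<tau> x} \<le> b"
  shows "card {x \<in> I \<rightarrow>\<^sub>E X. \<tau> (x i) = \<tau> (x j)} \<le> card X ^ (card I - 1) * b"
proof -
  define J where "J = I - {j}"
  have J: "I = insert j J" "j \<notin> J" "finite J" "i \<in> J" "card J = card I - 1"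
    using assms by (auto simp: J_def)
  have "{x \<in> I \<rightarrow>\<^sub>E X. \<tau> (x i) = \<tau> (x j)} \<subseteq>
      (\<lambda>(y, v). y(j := v)) ` (SIGMA y : (J \<rightarrow>\<^sub>E X). {v \<in> X. \<tau> v = \<tau> (y i)})"
  proof
    fix x assume x: "x \<in> {x \<in> I \<rightarrow>\<^sub>E X. \<tau> (x i) = \<tau> (x j)}"
    have "x(j := undefined) \<in> J \<rightarrow>\<^sub>E X"
      using x J by (auto simp: PiE_iff extensional_def)
    moreover have "x = (x(j := undefined))(j := x j)" by auto
    ultimately show "x \<in> (\<lambda>(y, v). y(j := v)) ` (SIGMA y : (J \<rightarrow>\<^sub>E X). {v \<in> X. \<tau> v = \<tau> (y i)})"
      using x J assms by (intro image_eqI[where x = "(x(j := undefined), x j)"]) auto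
  qed
  then have "card {x \<in> I \<rightarrow>\<^sub>E X. \<tau> (x i) = \<tau> (x j)} \<le>
      card (SIGMA y : (J \<rightarrow>\<^sub>E X). {v \<in> X. \<tau> v = \<tau> (y i)})"
    using assms J by (intro surj_card_le) (auto intro!: finite_PiE finite_SigmaI)
  also have "\<dots> = (\<Sum>y\<in>(J \<rightarrow>\<^sub>E X). card {v \<in> X. \<tau> v = \<tau> (y i)})"
    using assms J by (subst card_SigmaI) (auto intro!: finite_PiE)
  also have "\<dots> \<le> (\<Sum>y\<in>(J \<rightarrow>\<^sub>E X). b)"
    using J by (intro sum_mono b) auto
  also have "\<dots> = card X ^ (card I - 1) * b"
    using J assms by (simp add: card_PiE)
  finally show ?thesis .
qed

text \<open>Birthday bound: there are at most \<open>L\<^sup>2\<close> ordered pairs of coordinates,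
  each colliding with probability at most \<open>1 / (2 * L\<^sup>2)\<close>, so the collisions
  together have probability at most 1/2.\<close>

lemma card_tuples_inj_ge:
  fixes \<tau> :: "'a \<Rightarrow> 'b"
  assumes X: "finite X"
    and b: "\<And>x. x \<in> X \<Longrightarrow> card {x' \<in> X. \<tau> x' = \<tau> x} * (2 * L\<^sup>2) \<le> card X"
  shows "card X ^ L \<le> 2 * card {x \<in> {..<L} \<rightarrow>\<^sub>E X. inj_on (\<tau> \<circ> x) {..<L}}"
proof (cases "L = 0")
  case True
  have "{x \<in> {} \<rightarrow>\<^sub>E X. inj_on (\<tau> \<circ> x) {}} = {\<lambda>_. undefined}" by auto
  then show ?thesis using True by simp
next
  case False
  define P where "P = {..<L} \<rightarrow>\<^sub>E X"
  define b where "b = card X div (2 * L\<^sup>2)"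
  have fP: "finite P" using X by (auto simp: P_def intro: finite_PiE)
  have b': "card {x' \<in> X. \<tau> x' = \<tau> x} \<le> b" if "x \<in> X" for x
    unfolding b_def using b[OF that] False by (simp add: less_eq_div_iff_mult_less_eq)
  define B where "B = {x \<in> P. \<not> inj_on (\<tau> \<circ> x) {..<L}}"
  have "B \<subseteq> (\<Union>(i, j) \<in> {(i, j) \<in> {..<L} \<times> {..<L}. i \<noteq> j}. {x \<in> P. \<tau> (x i) = \<tau> (x j)})"
    by (auto simp: B_def inj_on_def)
  then have "card B \<le> card (\<Union>(i, j) \<in> {(i, j) \<in> {..<L} \<times> {..<L}. i \<noteq> j}. {x \<in> P. \<tau> (x i) = \<tau> (x j)})"
    using fP by (intro card_mono) (auto intro!: finite_UN_I intro: finite_subset[of _ "{..<L} \<times> {..<L}"])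
  also have "\<dots> \<le> (\<Sum>p \<in> {(i, j) \<in> {..<L} \<times> {..<L}. i \<noteq> j}.
      card (case p of (i, j) \<Rightarrow> {x \<in> P. \<tau> (x i) = \<tau> (x j)}))"
    by (rule card_UN_le) (auto intro: finite_subset[of _ "{..<L} \<times> {..<L}"])
  also have "\<dots> \<le> (\<Sum>p \<in> {(i, j) \<in> {..<L} \<times> {..<L}. i \<noteq> j}. card X ^ (L - 1) * b)"
  proof (rule sum_mono)
    fix p assume "p \<in> {(i, j) \<in> {..<L} \<times> {..<L}. i \<noteq> j}"
    then obtain i j where "p = (i, j)" "i < L" "j < L" "i \<noteq> j" by auto
    then show "card (case p of (i, j) \<Rightarrow> {x \<in> P. \<tau> (x i) = \<tau> (x j)}) \<le> card X ^ (L - 1) * b"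
      using card_tuples_same_value_le[of "{..<L}" X i j \<tau> b] X b' by (simp add: P_def)
  qed
  also have "\<dots> \<le> L\<^sup>2 * (card X ^ (L - 1) * b)"
  proof -
    have "card {(i, j) \<in> {..<L} \<times> {..<L}. i \<noteq> j} \<le> card ({..<L} \<times> {..<L})"
      by (rule card_mono) auto
    then show ?thesis by (simp add: power2_eq_square)
  qed
  finally have "2 * card B \<le> card X ^ (L - 1) * (2 * L\<^sup>2 * b)" by (simp add: mult_ac)
  also have "\<dots> \<le> card X ^ (L - 1) * card X"
    by (rule mult_left_mono) (simp_all add: b_def)
  also have "\<dots> = card X ^ L" using False by (cases L) auto
  finally have "2 * card B \<le> card X ^ L" .
  moreover have "card P = card B + card {x \<in> P. inj_on (\<tau> \<circ> x) {..<L}}"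
    unfolding B_def using fP
    by (subst card_Un_disjoint[symmetric]) (auto intro!: arg_cong[where f = card])
  moreover have "card P = card X ^ L" using X by (simp add: P_def card_PiE)
  ultimately show ?thesis by (simp add: P_def)
qed

section \<open>Shattering\<close>

definition shatters :: "'a set set \<Rightarrow> 'a set \<Rightarrow> bool" where
  "shatters F S \<longleftrightarrow> (\<forall>T\<subseteq>S. \<exists>f\<in>F. f \<inter> S = T)"

lemma shatters_subset:
  assumes "shatters F S" "S' \<subseteq> S"
  shows "shatters F S'"
  unfolding shatters_def
proof (intro allI impI)
  fix T assume "T \<subseteq> S'"
  then have "T \<subseteq> S" using assms by auto
  then obtain f where "f \<in> F" "f \<inter> S = T" using assms(1) unfolding shatters_def by meson
  then show "\<exists>f\<in>F. f \<inter> S' = T" using \<open>T \<subseteq> S'\<close> assms(2) by (intro bexI[of _ f]) auto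
qed

text \<open>Pajor's form of the Sauer-Shelah lemma. Splitting the family by membership of
  \<open>x\<close> and then forgetting \<open>x\<close> gives two families on \<open>X\<close>. A
  set shattered by either is shattered by \<open>F\<close>, and a set \<open>S\<close> shattered by
  both accounts for two shattered sets, \<open>S\<close> and \<open>insert x S\<close>.\<close>

lemma card_le_card_shattered:
  assumes "finite X" "F \<subseteq> Pow X"
  shows "card F \<le> card {S. S \<subseteq> X \<and> shatters F S}"
  using assms
proof (induction X arbitrary: F rule: finite_induct)
  case empty
  then have "F = {} \<or> F = {{}}" by auto
  then show ?case
  proof
    assume F: "F = {{}}"
    then have "{S. S \<subseteq> {} \<and> shatters F S} = {{}}" by (auto simp: shatters_def)
    then show ?case using F by (simp only: order_refl)
  qed simp
next
  case (insert x X)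
  define F0 where "F0 = {f \<in> F. x \<notin> f}"
  define F1 where "F1 = (\<lambda>f. f - {x}) ` {f \<in> F. x \<in> f}"
  define Sh where "Sh G = {S. S \<subseteq> X \<and> shatters G S}" for G
  have finF: "finite F" using insert by (meson finite_Pow_iff finite_insert finite_subset)
  have sub: "F0 \<subseteq> Pow X" "F1 \<subseteq> Pow X" using insert.prems by (auto simp: F0_def F1_def)
  have finSh: "finite (Sh G)" for G using insert.hyps by (simp add: Sh_def)
  have "inj_on (\<lambda>f. f - {x}) {f \<in> F. x \<in> f}"
    by (rule inj_onI) (metis (mono_tags, lifting) insert_Diff mem_Collect_eq)
  then have "card F1 = card {f \<in> F. x \<in> f}" by (simp add: F1_def card_image)
  moreover have "card F = card F0 + card {f \<in> F. x \<in> f}"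
    unfolding F0_def using finF
    by (subst card_Un_disjoint[symmetric]) (auto intro!: arg_cong[where f = card])
  ultimately have "card F = card F0 + card F1" by simp
  also have "\<dots> \<le> card (Sh F0) + card (Sh F1)"
    unfolding Sh_def by (intro add_mono insert.IH sub)
  also have "\<dots> = card (Sh F0 \<union> Sh F1) + card (Sh F0 \<inter> Sh F1)"
    by (rule card_Un_Int) (auto simp: finSh)
  also have "card (Sh F0 \<inter> Sh F1) = card (insert x ` (Sh F0 \<inter> Sh F1))"
    using insert.hyps(2)
    by (intro card_image[symmetric] inj_onI) (metis (mono_tags, lifting) IntD1 Sh_def in_mono insert_ident mem_Collect_eq)
  also have "card (Sh F0 \<union> Sh F1) + card (insert x ` (Sh F0 \<inter> Sh F1)) =
      card (Sh F0 \<union> Sh F1 \<union> insert x ` (Sh F0 \<inter> Sh F1))"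
  proof (intro card_Un_disjoint[symmetric])
    show "(Sh F0 \<union> Sh F1) \<inter> insert x ` (Sh F0 \<inter> Sh F1) = {}"
      using insert.hyps(2) by (auto simp: Sh_def)
  qed (simp_all add: finSh)
  also have "\<dots> \<le> card {S. S \<subseteq> insert x X \<and> shatters F S}"
  proof (rule card_mono)
    show "finite {S. S \<subseteq> insert x X \<and> shatters F S}" using insert.hyps by simp
    have sh0: "shatters F S" if "S \<subseteq> X" "shatters F0 S" for S
      using that(2) unfolding shatters_def by (metis (no_types, lifting) F0_def mem_Collect_eq)
    have sh1: "shatters F S" if S: "S \<subseteq> X" "shatters F1 S" for S
      unfolding shatters_def
    proof (intro allI impI)
      fix T assume "T \<subseteq> S"
      then obtain g where "g \<in> F1" "g \<inter> S = T" using S(2) by (auto simp: shatters_def)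
      then obtain f where f: "f \<in> F" "(f - {x}) \<inter> S = T" by (auto simp: F1_def)
      then show "\<exists>f\<in>F. f \<inter> S = T"
        using S(1) insert.hyps(2) by (intro bexI[of _ f]) auto
    qed
    have sh2: "shatters F (insert x S)" if S: "S \<subseteq> X" "shatters F0 S" "shatters F1 S" for S
      unfolding shatters_def
    proof (intro allI impI)
      fix T assume T: "T \<subseteq> insert x S"
      show "\<exists>f\<in>F. f \<inter> insert x S = T"
      proof (cases "x \<in> T")
        case True
        have "T - {x} \<subseteq> S" using T by auto
        then obtain g where "g \<in> F1" "g \<inter> S = T - {x}" using S(3) unfolding shatters_def by meson
        then obtain f where "f \<in> F" "x \<in> f" "(f - {x}) \<inter> S = T - {x}" by (auto simp: F1_def)
        then show ?thesis using True S(1) insert.hyps(2) by (intro bexI[of _ f]) auto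
      next
        case False
        then have "T \<subseteq> S" using T by auto
        then obtain f where "f \<in> F0" "f \<inter> S = T" using S(2) unfolding shatters_def by meson
        then have "f \<in> F" "x \<notin> f" "f \<inter> S = T" by (auto simp: F0_def)
        then show ?thesis by (intro bexI[of _ f]) auto
      qed
    qed
    show "Sh F0 \<union> Sh F1 \<union> insert x ` (Sh F0 \<inter> Sh F1) \<subseteq> {S. S \<subseteq> insert x X \<and> shatters F S}"
      unfolding Sh_def using sh0 sh1 sh2 by blast
  qed
  finally show ?case .
qed

text \<open>A set with fewer than \<open>k\<close> elements is listed by a \<open>k\<close>-tuple
  over \<open>Y\<close> padded with \<open>None\<close>. This crude bound replaces the sum of
  binomial coefficients; only being polynomial in \<open>card Y\<close> matters.\<close>

lemma card_small_subsets_le: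
  assumes "finite Y"
  shows "card {S. S \<subseteq> Y \<and> card S < k} \<le> (card Y + 1) ^ k"
proof -
  define P where "P = {..<k} \<rightarrow>\<^sub>E insert None (Some ` Y)"
  have "{S. S \<subseteq> Y \<and> card S < k} \<subseteq> (\<lambda>f. {y. Some y \<in> f ` {..<k}}) ` P"
  proof
    fix S assume "S \<in> {S. S \<subseteq> Y \<and> card S < k}"
    then have S: "S \<subseteq> Y" "card S < k" "finite S" using assms by (auto intro: finite_subset)
    obtain e where e: "bij_betw e {0..<card S} S" using ex_bij_betw_nat_finite[OF S(3)] by auto
    define f where "f = (\<lambda>i\<in>{..<k}. if i < card S then Some (e i) else None)"
    have "e i \<in> Y" if "i < card S" for i using S e that by (auto simp: bij_betw_def)
    then have "f \<in> P" by (auto simp: P_def f_def)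
    moreover have "S = {y. Some y \<in> f ` {..<k}}"
    proof (intro equalityI subsetI)
      fix y assume "y \<in> S"
      then have "y \<in> e ` {0..<card S}" using e by (simp add: bij_betw_def)
      then obtain i where "i < card S" "y = e i" by auto
      then show "y \<in> {y. Some y \<in> f ` {..<k}}"
        using S by (auto simp: f_def image_iff intro!: bexI[of _ i])
    next
      fix y assume "y \<in> {y. Some y \<in> f ` {..<k}}"
      then show "y \<in> S" using e by (auto simp: f_def bij_betw_def split: if_splits)
    qed
    ultimately show "S \<in> (\<lambda>f. {y. Some y \<in> f ` {..<k}}) ` P" by blast
  qed
  then have "card {S. S \<subseteq> Y \<and> card S < k} \<le> card P"
    using assms by (intro surj_card_le) (auto simp: P_def intro: finite_PiE)
  also have "\<dots> = (card Y + 1) ^ k"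
    using assms by (simp add: P_def card_PiE card_insert_if image_iff card_image)
  finally show ?thesis .
qed

text \<open>If only sets of fewer than \<open>k\<close> elements were shattered, they would be too
  few for Pajor's count. A larger shattered set is trimmed to size exactly \<open>k\<close>, since
  its elements will be labelled bijectively.\<close>

lemma sauer_shelah:
  assumes "finite Y" "F \<subseteq> Pow Y" "card F > (card Y + 1) ^ k"
  obtains K where "K \<subseteq> Y" "card K = k" "shatters F K"
proof -
  have "\<not> {S. S \<subseteq> Y \<and> shatters F S} \<subseteq> {S. S \<subseteq> Y \<and> card S < k}"
  proof
    assume "{S. S \<subseteq> Y \<and> shatters F S} \<subseteq> {S. S \<subseteq> Y \<and> card S < k}"
    then have "card {S. S \<subseteq> Y \<and> shatters F S} \<le> card {S. S \<subseteq> Y \<and> card S < k}"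
      using assms by (intro card_mono) auto
    then show False
      using assms card_le_card_shattered[OF assms(1,2)] card_small_subsets_le[OF assms(1), of k] by simp
  qed
  then obtain S where "S \<in> {S. S \<subseteq> Y \<and> shatters F S}" "S \<notin> {S. S \<subseteq> Y \<and> card S < k}" by blast
  then have "S \<subseteq> Y" "shatters F S" "k \<le> card S" by auto
  then obtain K where "K \<subseteq> S" "card K = k" by (meson obtain_subset_with_card_n)
  then show ?thesis using that \<open>S \<subseteq> Y\<close> \<open>shatters F S\<close> shatters_subset by blast
qed

text \<open>The shattered columns contain one block of t columns for every map f on row indices; on the block
  of f, the i-th row shows row f i of A. Whatever order these rows have in M, the block of their
  ranking map is a copy. The s extra columns keep the rows distinct even if A has equal rows.\<close>

lemma shattered_columns_contain_copy:
  assumes K: "finite K" "K \<subseteq> {..<n}" "card K = t * s ^ s + s" and X: "X \<subseteq> {..<n}"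
    and sh: "\<And>T. T \<subseteq> K \<Longrightarrow> \<exists>r\<in>X. {c \<in> K. M r c} = T"
  obtains R C where "R \<subseteq> X" "C \<subseteq> K" "is_copy s t A n M (R, C)"
proof -
  define Fn :: "(nat \<Rightarrow> nat) set" where "Fn = {..<s} \<rightarrow>\<^sub>E {..<s}"
  have fFn: "finite Fn" "card Fn = s ^ s" by (auto simp: Fn_def card_PiE intro: finite_PiE)
  have "card ((Fn \<times> {..<t}) <+> {..<s}) = card K"
    using fFn K by (simp add: card_Plus card_cartesian_product mult.commute)
  then obtain \<phi> where \<phi>: "bij_betw \<phi> ((Fn \<times> {..<t}) <+> {..<s}) K"
    using finite_same_card_bij[of "(Fn \<times> {..<t}) <+> {..<s}" K] fFn K by auto
  then have inj: "inj_on \<phi> ((Fn \<times> {..<t}) <+> {..<s})"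
    and im: "\<phi> ` ((Fn \<times> {..<t}) <+> {..<s}) = K" by (auto simp: bij_betw_def)
  define B where "B f = (\<lambda>j. \<phi> (Inl (f, j))) ` {..<t}" for f
  define e where "e i = \<phi> (Inr i)" for i
  have BK: "B f \<subseteq> K" if "f \<in> Fn" for f using im that by (auto simp: B_def)
  have cardB: "card (B f) = t" if "f \<in> Fn" for f
    using inj that unfolding B_def by (subst card_image) (auto simp: inj_on_def)
  have Bdisj: "f = f'" if "c \<in> B f" "c \<in> B f'" "f \<in> Fn" "f' \<in> Fn" for c f f'
    using that inj by (auto simp: B_def inj_on_def)
  have eK: "e i \<in> K" if "i < s" for i using im that by (auto simp: e_def)
  have eB: "e i \<notin> B f" if "i < s" "f \<in> Fn" for i f
    using inj that by (auto simp: B_def e_def inj_on_def)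
  have einj: "i = i'" if "e i = e i'" "i < s" "i' < s" for i i'
    using inj that by (auto simp: e_def inj_on_def)
  define P where "P i = {c \<in> K. \<exists>f\<in>Fn. c \<in> B f \<and> A (f i) (rank (B f) c)} \<union> {e i}" for i
  have "\<exists>r\<in>X. {c \<in> K. M r c} = P i" if "i < s" for i
    by (rule sh) (use eK that in \<open>auto simp: P_def\<close>)
  then obtain x where x: "\<And>i. i < s \<Longrightarrow> x i \<in> X" "\<And>i. i < s \<Longrightarrow> {c \<in> K. M (x i) c} = P i" by metis
  have injx: "inj_on x {..<s}"
  proof (rule inj_onI)
    fix i i' assume i: "i \<in> {..<s}" "i' \<in> {..<s}" "x i = x i'"
    then have "P i = P i'" using x(2) by (metis lessThan_iff)
    then have "e i \<in> P i'" by (auto simp: P_def)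
    then show "i = i'" using eB einj i by (auto simp: P_def)
  qed
  define R where "R = x ` {..<s}"
  have R: "finite R" "card R = s" "R \<subseteq> X" using injx x by (auto simp: R_def card_image)
  define f where "f = (\<lambda>i\<in>{..<s}. rank R (x i))"
  have f: "f \<in> Fn" using rank_less_card[OF R(1)] R(2) by (auto simp: f_def Fn_def R_def)
  have "M (x i) c = A (rank R (x i)) (rank (B f) c)" if i: "i < s" and c: "c \<in> B f" for i c
  proof -
    have "M (x i) c \<longleftrightarrow> c \<in> P i" using x(2)[OF i] BK[OF f] c by blast
    also have "\<dots> \<longleftrightarrow> A (f i) (rank (B f) c)"
      unfolding P_def using eB[OF i f] c f BK[OF f] Bdisj by blast
    finally show ?thesis using i by (simp add: f_def)
  qed
  then have "is_copy s t A n M (R, B f)"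
    unfolding is_copy_iff_rank using R X K BK[OF f] cardB[OF f] by (auto simp: R_def)
  then show ?thesis using that R BK[OF f] by blast
qed

text \<open>The traces of the rows on \<open>Y\<close> form the family for the Sauer-Shelah lemma;
  the exponent is the number of shattered columns that the construction of a copy consumes.\<close>

lemma many_traces_contain_copy:
  assumes Y: "Y \<subseteq> {..<n}" and X: "X \<subseteq> {..<n}"
    and big: "card ((\<lambda>r. {c \<in> Y. M r c}) ` X) > (card Y + 1) ^ (t * s ^ s + s)"
  obtains R C where "R \<subseteq> X" "C \<subseteq> Y" "is_copy s t A n M (R, C)"
proof -
  have fY: "finite Y" using Y by (auto intro: finite_subset)
  obtain K where K: "K \<subseteq> Y" "card K = t * s ^ s + s" "shatters ((\<lambda>r. {c \<in> Y. M r c}) ` X) K"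
    using sauer_shelah[OF fY _ big] by blast
  have "\<exists>r\<in>X. {c \<in> K. M r c} = T" if T: "T \<subseteq> K" for T
  proof -
    obtain r where "r \<in> X" "{c \<in> Y. M r c} \<inter> K = T" using K(3) T unfolding shatters_def by blast
    moreover have "{c \<in> Y. M r c} \<inter> K = {c \<in> K. M r c}" using K(1) by auto
    ultimately show ?thesis by auto
  qed
  moreover have "finite K" "K \<subseteq> {..<n}" using K(1) Y fY by (auto intro: finite_subset)
  ultimately obtain R C where "R \<subseteq> X" "C \<subseteq> K" "is_copy s t A n M (R, C)"
    using shattered_columns_contain_copy[of K n t s X M A] K(2) X by blast
  then show ?thesis using that K(1) by blast
qed

section \<open>Row clusters\<close>

text \<open>A random \<open>L\<close>-tuple of rows from \<open>X\<close> shows \<open>L\<close>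
  different traces with probability at least 1/2, which is too many for the Sauer-Shelah bound, so
  it contains the rows of a copy with columns in \<open>Y\<close>. A fixed set of \<open>s\<close>
  rows lies in the tuple with probability at most \<open>(L / card X) ^ s\<close>, so copies must
  occur on many different row sets.\<close>

lemma card_row_sets_of_copies_ge:
  fixes M :: "nat \<Rightarrow> nat \<Rightarrow> bool"
  defines "tr Y r \<equiv> {c \<in> Y. M r c}"
  assumes s: "s \<ge> 1" and Y: "Y \<subseteq> {..<n}" "card Y \<le> m" and X: "X \<subseteq> {..<n}"
    and L: "L > (m + 1) ^ (t * s ^ s + s)"
    and rare: "\<And>x. x \<in> X \<Longrightarrow> card {x' \<in> X. tr Y x' = tr Y x} * (2 * L\<^sup>2) \<le> card X"
  shows "card X ^ s \<le> 2 * L ^ s * card {R. R \<subseteq> X \<and> (\<exists>C\<subseteq>Y. is_copy s t A n M (R, C))}"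
proof (cases "X = {}")
  case True
  then show ?thesis using s by (simp add: power_0_left)
next
  case False
  have fX: "finite X" using X by (auto intro: finite_subset)
  define \<R> where "\<R> = {R. R \<subseteq> X \<and> (\<exists>C\<subseteq>Y. is_copy s t A n M (R, C))}"
  define I where "I = {x \<in> {..<L} \<rightarrow>\<^sub>E X. inj_on (tr Y \<circ> x) {..<L}}"
  have fR: "finite \<R>" using fX by (auto simp: \<R>_def)
  have cR: "card R = s" "finite R" if "R \<in> \<R>" for R
    using that fX by (auto simp: \<R>_def is_copy_def intro: finite_subset)
  have fP: "finite ({..<L} \<rightarrow>\<^sub>E X)" using fX by (auto intro: finite_PiE)
  have "I \<subseteq> (\<Union>R\<in>\<R>. {x \<in> {..<L} \<rightarrow>\<^sub>E X. R \<subseteq> x ` {..<L}})"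
  proof
    fix x assume x: "x \<in> I"
    then have xX: "x ` {..<L} \<subseteq> X" by (auto simp: I_def)
    have "card (tr Y ` x ` {..<L}) = L"
      using x card_image[of "tr Y \<circ> x" "{..<L}"] by (simp add: I_def image_comp)
    moreover have "(card Y + 1) ^ (t * s ^ s + s) \<le> (m + 1) ^ (t * s ^ s + s)"
      using Y by (intro power_mono) auto
    ultimately have "card (tr Y ` x ` {..<L}) > (card Y + 1) ^ (t * s ^ s + s)"
      using L by simp
    then obtain R C where RC: "R \<subseteq> x ` {..<L}" "C \<subseteq> Y" "is_copy s t A n M (R, C)"
      using many_traces_contain_copy[OF Y(1), of "x ` {..<L}" t s M A] xX X
      unfolding tr_def by (metis order_trans)
    then have "R \<in> \<R>" using xX by (auto simp: \<R>_def)
    then show "x \<in> (\<Union>R\<in>\<R>. {x \<in> {..<L} \<rightarrow>\<^sub>E X. R \<subseteq> x ` {..<L}})"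
      using RC x by (auto simp: I_def)
  qed
  then have "card I \<le> card (\<Union>R\<in>\<R>. {x \<in> {..<L} \<rightarrow>\<^sub>E X. R \<subseteq> x ` {..<L}})"
    using fR fP by (intro card_mono) auto
  also have "\<dots> \<le> (\<Sum>R\<in>\<R>. card {x \<in> {..<L} \<rightarrow>\<^sub>E X. R \<subseteq> x ` {..<L}})"
    by (rule card_UN_le[OF fR])
  finally have "card I * card X ^ s \<le> (\<Sum>R\<in>\<R>. card {x \<in> {..<L} \<rightarrow>\<^sub>E X. R \<subseteq> x ` {..<L}} * card X ^ s)"
    by (simp add: sum_distrib_right[symmetric])
  also have "\<dots> \<le> (\<Sum>R\<in>\<R>. L ^ s * card X ^ L)"
  proof (rule sum_mono)
    fix R assume "R \<in> \<R>"
    then show "card {x \<in> {..<L} \<rightarrow>\<^sub>E X. R \<subseteq> x ` {..<L}} * card X ^ s \<le> L ^ s * card X ^ L"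
      using card_tuples_covering_le[of "{..<L}" X R] cR fX by simp
  qed
  finally have 1: "card I * card X ^ s \<le> card \<R> * (L ^ s * card X ^ L)" by simp
  have "card X ^ L * card X ^ s \<le> 2 * card I * card X ^ s"
    using card_tuples_inj_ge[OF fX, of "tr Y" L] rare unfolding I_def by simp
  also have "\<dots> \<le> card X ^ L * (2 * L ^ s * card \<R>)" using 1 by (simp add: mult_ac)
  finally have "card X ^ s \<le> 2 * L ^ s * card \<R>" using False fX by (simp add: card_gt_0_iff)
  then show ?thesis by (simp add: \<R>_def)
qed

text \<open>Every sample in \<open>H\<close> captures at least \<open>n ^ s / D\<close> copies, one
  per row set, while the columns of a fixed copy lie in a random sample with probability at most
  \<open>(m / n) ^ t\<close>. The bound comes from counting pairs of a sample and a captured copy in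
  both orders.\<close>

lemma card_copies_ge_of_columns:
  fixes M :: "nat \<Rightarrow> nat \<Rightarrow> bool"
  assumes n: "n > 0" and H: "H \<subseteq> {..<m} \<rightarrow>\<^sub>E {..<n}" "n ^ m \<le> 2 * card H"
    and D: "\<And>y. y \<in> H \<Longrightarrow>
      n ^ s \<le> D * card {R. R \<subseteq> {..<n} \<and> (\<exists>C\<subseteq>y ` {..<m}. is_copy s t A n M (R, C))}"
  shows "n ^ (s + t) \<le> 2 * D * m ^ t * card (copies s t A n M)"
proof -
  define \<C> where "\<C> = copies s t A n M"
  have f\<C>: "finite \<C>" by (simp add: \<C>_def finite_copies)
  have fH: "finite H" using H(1) by (rule finite_subset) (auto intro: finite_PiE)
  have "n ^ m * n ^ s \<le> 2 * (\<Sum>y\<in>H. n ^ s)" using H(2) by simp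
  also have "(\<Sum>y\<in>H. n ^ s) \<le> (\<Sum>y\<in>H. D * card {RC \<in> \<C>. snd RC \<subseteq> y ` {..<m}})"
  proof (rule sum_mono)
    fix y assume y: "y \<in> H"
    have "{R. R \<subseteq> {..<n} \<and> (\<exists>C\<subseteq>y ` {..<m}. is_copy s t A n M (R, C))} \<subseteq>
        fst ` {RC \<in> \<C>. snd RC \<subseteq> y ` {..<m}}"
      by (force simp: \<C>_def copies_def)
    then have "card {R. R \<subseteq> {..<n} \<and> (\<exists>C\<subseteq>y ` {..<m}. is_copy s t A n M (R, C))} \<le>
        card {RC \<in> \<C>. snd RC \<subseteq> y ` {..<m}}"
      using f\<C> by (intro surj_card_le) auto
    then show "n ^ s \<le> D * card {RC \<in> \<C>. snd RC \<subseteq> y ` {..<m}}"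
      using D[OF y] by (meson le_trans mult_le_mono2)
  qed
  also have "\<dots> = D * (\<Sum>y\<in>H. \<Sum>RC\<in>\<C>. if snd RC \<subseteq> y ` {..<m} then 1 else 0)"
    using f\<C> by (simp add: sum_distrib_left[symmetric] sum.If_cases Int_def)
  also have "\<dots> = D * (\<Sum>RC\<in>\<C>. card {y \<in> H. snd RC \<subseteq> y ` {..<m}})"
    using fH by (subst sum.swap) (simp add: sum.If_cases Int_def)
  finally have "n ^ m * n ^ s * n ^ t \<le>
      2 * (D * (\<Sum>RC\<in>\<C>. card {y \<in> H. snd RC \<subseteq> y ` {..<m}})) * n ^ t"
    by (intro mult_right_mono) auto
  also have "\<dots> = 2 * D * (\<Sum>RC\<in>\<C>. card {y \<in> H. snd RC \<subseteq> y ` {..<m}} * n ^ t)"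
    by (simp add: sum_distrib_right[symmetric])
  also have "\<dots> \<le> 2 * D * (\<Sum>RC\<in>\<C>. m ^ t * n ^ m)"
  proof (intro mult_left_mono sum_mono)
    fix RC assume "RC \<in> \<C>"
    then have c: "finite (snd RC)" "card (snd RC) = t"
      by (auto simp: \<C>_def copies_def is_copy_def intro: finite_subset split: prod.splits)
    have "card {y \<in> H. snd RC \<subseteq> y ` {..<m}} \<le> card {y \<in> {..<m} \<rightarrow>\<^sub>E {..<n}. snd RC \<subseteq> y ` {..<m}}"
      using H(1) by (intro card_mono) (auto simp: finite_PiE)
    then show "card {y \<in> H. snd RC \<subseteq> y ` {..<m}} * n ^ t \<le> m ^ t * n ^ m"
      using card_tuples_covering_le[of "{..<m}" "{..<n}" "snd RC"] c
      by (simp add: le_trans[OF mult_le_mono1])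
  qed simp
  finally have "n ^ m * n ^ (s + t) \<le> n ^ m * (2 * D * m ^ t * card \<C>)"
    by (simp add: power_add mult_ac)
  then show ?thesis using n by (simp add: \<C>_def)
qed

lemma exists_le_average:
  fixes f :: "'a \<Rightarrow> nat"
  assumes "finite K" "K \<noteq> {}"
  obtains v where "v \<in> K" "card K * f v \<le> (\<Sum>x\<in>K. f x)"
proof -
  obtain v where v: "v \<in> K" "\<And>x. x \<in> K \<Longrightarrow> f v \<le> f x"
    using assms by (metis arg_min_if_finite(1) arg_min_least)
  then have "card K * f v \<le> (\<Sum>x\<in>K. f x)"
    using sum_bounded_below[of K "f v" f] by simp
  then show ?thesis using that v by blast
qed

text \<open>\<open>cl\<close> will be the trace on a column sample and \<open>d\<close> the Hamming
  distance. A class is rare if it has fewer than \<open>n / q\<close> members, so at most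
  \<open>q\<close> classes are not rare; in each of these the representative is a member with at
  most the average number of members farther than \<open>n / w\<close> from it. The factor 3 stands
  for near rows, rows of rare classes and far rows, which cost at most \<open>n\<^sup>2 / w\<close>
  each.\<close>

lemma exists_representatives:
  fixes cl :: "nat \<Rightarrow> 'b" and d :: "nat \<Rightarrow> nat \<Rightarrow> nat"
  assumes n: "n > 0" and d: "\<And>r r'. d r r' \<le> n"
    and rare: "w * card {r \<in> {..<n}. card {r' \<in> {..<n}. cl r' = cl r} * q < n} \<le> n"
    and far: "w * q * card {(r, r') \<in> {..<n} \<times> {..<n}. cl r = cl r' \<and> n < w * d r r'} \<le> n\<^sup>2"
  obtains \<rho> where "\<rho> ` {..<n} \<subseteq> {..<n}" "card (\<rho> ` {..<n}) \<le> q + 1"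
    "w * (\<Sum>r<n. d r (\<rho> r)) \<le> 3 * n\<^sup>2"
proof -
  define K where "K b = {r \<in> {..<n}. cl r = b}" for b
  have fK: "finite (K b)" for b by (simp add: K_def)
  define F where "F b v = card {r \<in> K b. n < w * d r v}" for b v
  define Ra where "Ra = {r \<in> {..<n}. card (K (cl r)) * q < n}"
  have Ra: "w * card Ra \<le> n" using rare by (simp add: Ra_def K_def)
  have "\<exists>v. v \<in> K b \<and> card (K b) * F b v \<le> (\<Sum>v\<in>K b. F b v)" if "b \<in> cl ` {..<n}" for b
  proof -
    have "K b \<noteq> {}" using that by (auto simp: K_def)
    then show ?thesis using exists_le_average[OF fK, of b "F b"] by metis
  qed
  then obtain rp where rp: "\<And>b. b \<in> cl ` {..<n} \<Longrightarrow> rp b \<in> K b"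
      "\<And>b. b \<in> cl ` {..<n} \<Longrightarrow> card (K b) * F b (rp b) \<le> (\<Sum>v\<in>K b. F b v)"
    by metis
  \<comment> \<open>Rows of rare classes share the arbitrary representative 0 and may cost the full
    distance \<open>n\<close> each; this value accounts for the 1 in \<open>q + 1\<close>.\<close>
  define \<rho> where "\<rho> r = (if r \<in> Ra then 0 else rp (cl r))" for r
  define N where "N = cl ` ({..<n} - Ra)"
  have fN: "finite N" by (simp add: N_def)
  have NK: "n \<le> card (K b) * q" if "b \<in> N" for b using that by (auto simp: N_def Ra_def not_less)
  have Nsub: "N \<subseteq> cl ` {..<n}" by (auto simp: N_def)
  have Kdisj: "K b \<inter> K b' = {}" if "b \<noteq> b'" for b b' using that by (auto simp: K_def)
  have im: "\<rho> ` {..<n} \<subseteq> insert 0 (rp ` N)" by (auto simp: \<rho>_def N_def)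
  have "card N \<le> q"
  proof -
    have "card N * n \<le> (\<Sum>b\<in>N. card (K b) * q)" using NK sum_bounded_below[of N n] by simp
    also have "\<dots> = card (\<Union>b\<in>N. K b) * q"
      using fN fK Kdisj by (subst card_UN_disjoint) (auto simp: sum_distrib_right)
    also have "\<dots> \<le> n * q"
      using card_mono[of "{..<n}" "\<Union>b\<in>N. K b"] by (intro mult_right_mono) (auto simp: K_def)
    finally show ?thesis using n by simp
  qed
  moreover have "card (\<rho> ` {..<n}) \<le> card (insert 0 (rp ` N))"
    using im fN by (intro card_mono) auto
  moreover have "card (insert 0 (rp ` N)) \<le> card N + 1"
    using card_image_le[OF fN, of rp] fN by (simp add: card_insert_if)
  ultimately have c: "card (\<rho> ` {..<n}) \<le> q + 1" by simp
  have sub: "\<rho> ` {..<n} \<subseteq> {..<n}"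
    using rp(1) n by (fastforce simp: \<rho>_def K_def)
  define Fa where "Fa = {r \<in> {..<n} - Ra. n < w * d r (\<rho> r)}"
  have "Fa \<subseteq> (\<Union>b\<in>N. {r \<in> K b. n < w * d r (rp b)})"
    by (auto simp: Fa_def N_def K_def \<rho>_def)
  then have "card Fa \<le> card (\<Union>b\<in>N. {r \<in> K b. n < w * d r (rp b)})"
    using fN fK by (intro card_mono) auto
  also have "\<dots> \<le> (\<Sum>b\<in>N. F b (rp b))" unfolding F_def by (rule card_UN_le[OF fN])
  finally have "w * (n * card Fa) \<le> w * (\<Sum>b\<in>N. n * F b (rp b))"
    by (simp add: sum_distrib_left[symmetric])
  also have "\<dots> \<le> w * (\<Sum>b\<in>N. q * (\<Sum>v\<in>K b. F b v))"
  proof (intro mult_left_mono sum_mono)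
    fix b assume b: "b \<in> N"
    \<comment> \<open>The class has at least \<open>n / q\<close> members, so its number of far
      ordered pairs bounds the number of far members of an average representative.\<close>
    have "n * F b (rp b) \<le> q * (card (K b) * F b (rp b))" using NK[OF b] by (simp add: mult.commute mult.left_commute)
    also have "\<dots> \<le> q * (\<Sum>v\<in>K b. F b v)" using rp(2)[of b] b Nsub by (intro mult_left_mono) auto
    finally show "n * F b (rp b) \<le> q * (\<Sum>v\<in>K b. F b v)" .
  qed simp
  also have "\<dots> = w * q * (\<Sum>b\<in>N. \<Sum>v\<in>K b. F b v)" by (simp add: sum_distrib_left[symmetric] mult_ac)
  also have "(\<Sum>b\<in>N. \<Sum>v\<in>K b. F b v) =
      card (SIGMA b:N. SIGMA v:K b. {r \<in> K b. n < w * d r v})"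
    using fN fK by (simp add: F_def card_SigmaI)
  also have "\<dots> \<le> card {(r, r') \<in> {..<n} \<times> {..<n}. cl r = cl r' \<and> n < w * d r r'}"
  proof (rule card_inj_on_le[where f = "\<lambda>(b, v, r). (r, v)"])
    show "finite {(r, r') \<in> {..<n} \<times> {..<n}. cl r = cl r' \<and> n < w * d r r'}"
      by (rule finite_subset[of _ "{..<n} \<times> {..<n}"]) auto
  qed (auto simp: inj_on_def K_def)
  finally have "w * (n * card Fa) \<le>
      w * q * card {(r, r') \<in> {..<n} \<times> {..<n}. cl r = cl r' \<and> n < w * d r r'}" by simp
  from le_trans[OF this far] have "n * (w * card Fa) \<le> n * n"
    by (simp add: power2_eq_square mult.left_commute)
  then have Fa: "w * card Fa \<le> n" using n by simp
  have pt: "w * d r (\<rho> r) \<le> n + ((if r \<in> Ra then w * n else 0) + (if r \<in> Fa then w * n else 0))"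
    if "r \<in> {..<n}" for r
  proof -
    have "w * d r (\<rho> r) \<le> w * n" using d by (rule mult_le_mono2)
    moreover have "w * d r (\<rho> r) \<le> n" if "r \<notin> Ra" "r \<notin> Fa"
      using that \<open>r \<in> {..<n}\<close> by (simp add: Fa_def)
    moreover have "a \<le> c + ((if P then b else 0) + (if Q then b else 0))"
      if "a \<le> b" "\<not> P \<Longrightarrow> \<not> Q \<Longrightarrow> a \<le> c" for a b c :: nat and P Q using that by auto
    ultimately show ?thesis by blast
  qed
  have "w * (\<Sum>r<n. d r (\<rho> r)) \<le>
      (\<Sum>r<n. n + ((if r \<in> Ra then w * n else 0) + (if r \<in> Fa then w * n else 0)))"
    unfolding sum_distrib_left by (rule sum_mono[OF pt])
  also have "\<dots> = n * n + (w * card Ra * n + w * card Fa * n)"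
  proof -
    have "{..<n} \<inter> Ra = Ra" "{..<n} \<inter> Fa = Fa" by (auto simp: Ra_def Fa_def)
    then show ?thesis by (simp add: sum.distrib sum.If_cases mult_ac)
  qed
  also have "\<dots> \<le> n * n + (n * n + n * n)"
    using Ra Fa by (intro add_mono mult_right_mono) auto
  finally have "w * (\<Sum>r<n. d r (\<rho> r)) \<le> 3 * n\<^sup>2" by (simp add: power2_eq_square)
  then show ?thesis using that c sub by blast
qed

section \<open>Distances of rows and random column samples\<close>

definition row_dist :: "nat \<Rightarrow> (nat \<Rightarrow> nat \<Rightarrow> bool) \<Rightarrow> nat \<Rightarrow> nat \<Rightarrow> nat" where
  "row_dist n M r r' = card {c \<in> {..<n}. M r c \<noteq> M r' c}"

lemma row_dist_le: "row_dist n M r r' \<le> n"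
  unfolding row_dist_def using card_mono[of "{..<n}" "{c \<in> {..<n}. M r c \<noteq> M r' c}"] by auto

text \<open>Two rows have equal traces exactly if all \<open>m\<close> sampled columns avoid the
  columns where they differ. For rows more than \<open>n / w\<close> apart this has probability at
  most \<open>(1 - 1 / w) ^ m\<close>; summing over the pairs and exchanging the sums gives the
  total over all samples.\<close>

lemma sum_far_pairs_same_trace_le:
  fixes M :: "nat \<Rightarrow> nat \<Rightarrow> bool" and w m n :: nat
  defines "tr Y r \<equiv> {c \<in> Y. M r c}"
  defines "fp y \<equiv> card {(r, r') \<in> {..<n} \<times> {..<n}.
      tr (y ` {..<m}) r = tr (y ` {..<m}) r' \<and> n < w * row_dist n M r r'}"
  shows "w ^ m * (\<Sum>y\<in>{..<m} \<rightarrow>\<^sub>E {..<n}. fp y) \<le> n\<^sup>2 * ((w - 1) * n) ^ m"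
proof -
  define P where "P = {..<m::nat} \<rightarrow>\<^sub>E {..<n}"
  define FP where "FP = {(r, r') \<in> {..<n} \<times> {..<n}. n < w * row_dist n M r r'}"
  define ag where "ag y p \<longleftrightarrow> tr (y ` {..<m}) (fst p) = tr (y ` {..<m}) (snd p)"
    for y :: "nat \<Rightarrow> nat" and p
  have fP: "finite P" by (auto simp: P_def intro: finite_PiE)
  have fF: "finite FP" unfolding FP_def by (rule finite_subset[of _ "{..<n} \<times> {..<n}"]) auto
  have cF: "card FP \<le> n\<^sup>2"
    using card_mono[of "{..<n} \<times> {..<n}" FP] by (auto simp: FP_def power2_eq_square)
  have "fp y = card {p \<in> FP. ag y p}" for y
    unfolding fp_def FP_def ag_def by (rule arg_cong[where f = card]) auto
  then have "(\<Sum>y\<in>P. fp y) = (\<Sum>y\<in>P. \<Sum>p\<in>FP. if ag y p then 1 else 0)"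
    using fF by (simp add: sum.If_cases Int_def)
  also have "\<dots> = (\<Sum>p\<in>FP. card {y \<in> P. ag y p})"
    using fP by (subst sum.swap) (simp add: sum.If_cases Int_def)
  finally have "w ^ m * (\<Sum>y\<in>P. fp y) = (\<Sum>p\<in>FP. w ^ m * card {y \<in> P. ag y p})"
    by (simp add: sum_distrib_left)
  also have "\<dots> \<le> (\<Sum>p\<in>FP. ((w - 1) * n) ^ m)"
  proof (rule sum_mono)
    fix p assume "p \<in> FP"
    then obtain r r' where p: "p = (r, r')" "n < w * row_dist n M r r'" by (auto simp: FP_def)
    have "{y \<in> P. ag y p} = {..<m} \<rightarrow>\<^sub>E {c \<in> {..<n}. M r c = M r' c}"
      unfolding P_def ag_def tr_def p by (fastforce simp: PiE_iff set_eq_iff image_iff)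
    moreover have "card {c \<in> {..<n}. M r c = M r' c} = n - row_dist n M r r'"
    proof -
      have "{c \<in> {..<n}. M r c = M r' c} = {..<n} - {c \<in> {..<n}. M r c \<noteq> M r' c}" by auto
      then have "card {c \<in> {..<n}. M r c = M r' c} = card {..<n} - card {c \<in> {..<n}. M r c \<noteq> M r' c}"
        by (simp only:) (rule card_Diff_subset, auto)
      then show ?thesis by (simp add: row_dist_def)
    qed
    ultimately have "w ^ m * card {y \<in> P. ag y p} = (w * (n - row_dist n M r r')) ^ m"
      by (simp add: card_PiE power_mult_distrib)
    also have "\<dots> \<le> ((w - 1) * n) ^ m"
      using p(2) by (intro power_mono) (auto simp: diff_mult_distrib diff_mult_distrib2)
    finally show "w ^ m * card {y \<in> P. ag y p} \<le> ((w - 1) * n) ^ m" .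
  qed
  also have "\<dots> \<le> n\<^sup>2 * ((w - 1) * n) ^ m" using cF by simp
  finally show ?thesis by (simp add: P_def)
qed

text \<open>Bernoulli's inequality in the form \<open>(1 - 1 / w) ^ p \<le> 1 / (1 + p / w)\<close>.
  The gain is only linear in \<open>p\<close>, so it will be applied to blocks of length
  \<open>p\<close> and then raised to a power.\<close>

lemma pred_power_mult_le:
  fixes w :: nat
  assumes "w \<ge> 1"
  shows "(w - 1) ^ p * (w + p) \<le> w ^ (p + 1)"
proof (induction p)
  case (Suc p)
  obtain u where u: "w = Suc u" using assms by (cases w) auto
  have "(w - 1) * (w + Suc p) \<le> w * (w + p)" by (simp add: u algebra_simps)
  then have "(w - 1) ^ p * ((w - 1) * (w + Suc p)) \<le> (w - 1) ^ p * (w * (w + p))"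
    by (rule mult_le_mono2)
  also have "\<dots> \<le> w * w ^ (p + 1)" using mult_le_mono2[OF Suc.IH, of w] by (simp add: mult_ac)
  finally show ?case by (simp only: power_Suc power_add add_Suc mult_ac)
qed simp

text \<open>Two rows at distance more than n / w agree on m random columns with probability at most
  (1 - 1/w)^m; the sample size makes this smaller than the polynomial class threshold.\<close>

definition sample_size :: "nat \<Rightarrow> nat \<Rightarrow> nat" where
  "sample_size k w = (4 * k + 4) * ((8 * k + 8) * w\<^sup>2)"

text \<open>The difficulty is that \<open>L\<close> grows with \<open>m\<close> itself. With
  \<open>m = j * p\<close> and \<open>p = c * w\<^sup>2\<close>, each of the \<open>j\<close> blocks
  of \<open>p\<close> samples gains a factor \<open>c * w\<close>, whereas
  \<open>2 * m = (c * w)\<^sup>2\<close> makes \<open>L\<^sup>2\<close> at most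
  \<open>4 * (c * w) ^ (4 * k)\<close>. So \<open>j = 4 * k + 4\<close> leaves
  \<open>(c * w) ^ 4\<close> to cover the remaining \<open>16 * w\<^sup>2\<close>.\<close>

lemma sample_size_suffices:
  fixes k w :: nat
  assumes w: "w \<ge> 1"
  defines "m \<equiv> sample_size k w"
  defines "L \<equiv> (m + 1) ^ k + 1"
  shows "4 * w\<^sup>2 * L\<^sup>2 * (w - 1) ^ m \<le> w ^ m"
proof -
  define j where "j = 4 * k + 4"
  define c where "c = 2 * j"
  define p where "p = c * w\<^sup>2"
  have m: "m = j * p" by (simp add: m_def sample_size_def j_def c_def p_def)
  have "(w - 1) ^ p * (c * w) * w = (w - 1) ^ p * p" by (simp add: p_def power2_eq_square)
  also have "\<dots> \<le> (w - 1) ^ p * (w + p)" by simp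
  also have "\<dots> \<le> w ^ p * w" using pred_power_mult_le[OF w, of p] by (simp add: mult.commute)
  finally have "(w - 1) ^ p * (c * w) \<le> w ^ p" using w by simp
  then have "((w - 1) ^ p * (c * w)) ^ j \<le> (w ^ p) ^ j" by (rule power_mono) simp
  then have 1: "(w - 1) ^ m * (c * w) ^ j \<le> w ^ m"
    by (simp add: m power_mult_distrib power_mult[symmetric] mult.commute)
  have "m \<ge> 1" using w by (auto simp: m_def sample_size_def)
  then have "(m + 1) ^ k \<le> (2 * m) ^ k" by (intro power_mono) auto
  moreover have "1 \<le> (2 * m) ^ k" using \<open>m \<ge> 1\<close> by simp
  ultimately have "L \<le> 2 * (2 * m) ^ k" unfolding L_def by linarith
  also have "2 * m = c\<^sup>2 * w\<^sup>2" by (simp add: m p_def c_def power2_eq_square)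
  finally have "L\<^sup>2 \<le> (2 * (c\<^sup>2 * w\<^sup>2) ^ k)\<^sup>2" by (rule power_mono) simp
  also have "\<dots> = 4 * (c * w) ^ (4 * k)"
    by (simp add: power_mult_distrib power_mult[symmetric])
  finally have "4 * w\<^sup>2 * L\<^sup>2 \<le> 16 * w\<^sup>2 * (c * w) ^ (4 * k)" by simp
  also have "\<dots> \<le> (c * w) ^ 4 * (c * w) ^ (4 * k)"
  proof (rule mult_right_mono)
    have "16 \<le> c ^ 2" using power_mono[of 4 c 2] by (simp add: c_def j_def)
    moreover have "1 \<le> c\<^sup>2 * w\<^sup>2" using w by (simp add: c_def j_def)
    ultimately have "16 * w\<^sup>2 * 1 \<le> c\<^sup>2 * w\<^sup>2 * (c\<^sup>2 * w\<^sup>2)"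
      by (intro mult_mono) auto
    then show "16 * w\<^sup>2 \<le> (c * w) ^ 4"
      by (simp add: power_mult_distrib power2_eq_square power4_eq_xxxx mult_ac)
  qed simp
  also have "\<dots> = (c * w) ^ j" by (simp add: j_def power_add)
  finally have "4 * w\<^sup>2 * L\<^sup>2 * (w - 1) ^ m \<le> (c * w) ^ j * (w - 1) ^ m" by (rule mult_right_mono) simp
  also have "\<dots> \<le> w ^ m" using 1 by (simp only: mult.commute)
  finally show ?thesis .
qed

text \<open>A sample belongs to \<open>H\<close> if more than \<open>n / w\<close> rows have rare
  traces. If half of all samples did, there would be more copies than \<open>few\<close> allows.
  Among the others, which are more than half, one has at most their average number of far pairs with
  equal traces, hence at most twice the average over all samples.\<close>

lemma row_clusters_or_many_copies_explicit:
  fixes M :: "nat \<Rightarrow> nat \<Rightarrow> bool" and s t w n :: nat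
  assumes s: "s \<ge> 1" and w: "w \<ge> 1" and n: "n > 0"
  defines "k \<equiv> t * s ^ s + s"
  defines "m \<equiv> sample_size k w"
  defines "L \<equiv> (m + 1) ^ k + 1"
  assumes few: "n ^ (s + t) > 2 * (2 * (w * L) ^ s) * m ^ t * card (copies s t A n M)"
  obtains \<rho> where "\<rho> ` {..<n} \<subseteq> {..<n}" "card (\<rho> ` {..<n}) \<le> 2 * w * L\<^sup>2 + 1"
    "w * (\<Sum>r<n. row_dist n M r (\<rho> r)) \<le> 3 * n\<^sup>2"
proof -
  \<comment> \<open>\<open>q\<close> is tuned to the birthday bound: a class of fewer than
    \<open>n / q\<close> rows is at most a \<open>1 / (2 * L\<^sup>2)\<close> fraction of a set of
    more than \<open>n / w\<close> rows.\<close>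
  define q where "q = 2 * w * L\<^sup>2"
  define tr where "tr Y r = {c \<in> Y. M r c}" for Y r
  define P where "P = {..<m} \<rightarrow>\<^sub>E {..<n}"
  define K where "K y r = {r' \<in> {..<n}. tr (y ` {..<m}) r' = tr (y ` {..<m}) r}" for y r
  define X where "X y = {r \<in> {..<n}. card (K y r) * q < n}" for y
  define H where "H = {y \<in> P. n < w * card (X y)}"
  define fp where "fp y = card {(r, r') \<in> {..<n} \<times> {..<n}.
      tr (y ` {..<m}) r = tr (y ` {..<m}) r' \<and> n < w * row_dist n M r r'}" for y
  have fP: "finite P" "card P = n ^ m" by (auto simp: P_def card_PiE intro: finite_PiE)
  have "\<not> n ^ m \<le> 2 * card H"
  proof
    assume H: "n ^ m \<le> 2 * card H"
    have "n ^ s \<le> 2 * (w * L) ^ s *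
        card {R. R \<subseteq> {..<n} \<and> (\<exists>C\<subseteq>y ` {..<m}. is_copy s t A n M (R, C))}" if y: "y \<in> H" for y
    proof -
      have yn: "y ` {..<m} \<subseteq> {..<n}" using y by (auto simp: H_def P_def)
      have cy: "card (y ` {..<m}) \<le> m" using card_image_le[of "{..<m}" y] by simp
      have Xn: "X y \<subseteq> {..<n}" by (auto simp: X_def)
      have rare: "card {x' \<in> X y. tr (y ` {..<m}) x' = tr (y ` {..<m}) x} * (2 * L\<^sup>2) \<le> card (X y)"
        if x: "x \<in> X y" for x
      proof -
        have "card {x' \<in> X y. tr (y ` {..<m}) x' = tr (y ` {..<m}) x} \<le> card (K y x)"
          by (rule card_mono) (auto simp: K_def X_def)
        then have "w * (card {x' \<in> X y. tr (y ` {..<m}) x' = tr (y ` {..<m}) x} * (2 * L\<^sup>2)) \<le>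
            w * (card (K y x) * (2 * L\<^sup>2))"
          by (intro mult_left_mono mult_right_mono) auto
        also have "\<dots> = card (K y x) * q" by (simp add: q_def)
        also have "\<dots> \<le> w * card (X y)" using x y by (auto simp: X_def H_def)
        finally show ?thesis using w by simp
      qed
      have "n ^ s \<le> (w * card (X y)) ^ s" using y by (intro power_mono) (auto simp: H_def)
      also have "\<dots> = w ^ s * card (X y) ^ s" by (simp add: power_mult_distrib)
      also have "card (X y) ^ s \<le> 2 * L ^ s *
          card {R. R \<subseteq> X y \<and> (\<exists>C\<subseteq>y ` {..<m}. is_copy s t A n M (R, C))}"
        using card_row_sets_of_copies_ge[OF s yn cy Xn, where t = t and L = L and M = M and A = A] rare
        unfolding tr_def L_def k_def by simp
      also have "card {R. R \<subseteq> X y \<and> (\<exists>C\<subseteq>y ` {..<m}. is_copy s t A n M (R, C))} \<le>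
          card {R. R \<subseteq> {..<n} \<and> (\<exists>C\<subseteq>y ` {..<m}. is_copy s t A n M (R, C))}"
        using Xn by (intro card_mono) auto
      finally show ?thesis by (simp add: power_mult_distrib mult_ac)
    qed
    then have "n ^ (s + t) \<le> 2 * (2 * (w * L) ^ s) * m ^ t * card (copies s t A n M)"
      using H n by (intro card_copies_ge_of_columns[of n H]) (auto simp: H_def P_def)
    then show False using few by simp
  qed
  moreover have "card P = card H + card (P - H)"
    using fP card_mono[of P H] by (subst card_Diff_subset) (auto simp: H_def)
  ultimately have G': "n ^ m < 2 * card (P - H)" using fP by simp
  then have "P - H \<noteq> {}" by (metis card.empty less_zeroE mult_0_right)
  with G' have G: "n ^ m \<le> 2 * card (P - H)" "P - H \<noteq> {}" by simp_all
  obtain y where y: "y \<in> P - H" "card (P - H) * fp y \<le> (\<Sum>y\<in>P - H. fp y)"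
    using exists_le_average[of "P - H" fp] fP G by auto
  have "w ^ m * fp y * n ^ m \<le> w ^ m * fp y * (2 * card (P - H))" using G by simp
  also have "\<dots> \<le> 2 * (w ^ m * (\<Sum>y\<in>P - H. fp y))" using y by (simp add: mult.commute)
  also have "\<dots> \<le> 2 * (w ^ m * (\<Sum>y\<in>P. fp y))"
    using fP by (intro mult_left_mono sum_mono2) auto
  also have "\<dots> \<le> 2 * (n\<^sup>2 * ((w - 1) * n) ^ m)"
    using sum_far_pairs_same_trace_le[where w = w and m = m and n = n and M = M] by (simp add: P_def fp_def tr_def)
  also have "\<dots> = 2 * (n\<^sup>2 * (w - 1) ^ m) * n ^ m" by (simp add: power_mult_distrib)
  finally have fp: "w ^ m * fp y \<le> 2 * (n\<^sup>2 * (w - 1) ^ m)" using n by simp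
  have "w ^ m * (w * q * fp y) = w * q * (w ^ m * fp y)" by simp
  also have "\<dots> \<le> w * q * (2 * (n\<^sup>2 * (w - 1) ^ m))" using fp by (rule mult_left_mono) simp
  also have "\<dots> = n\<^sup>2 * (4 * w\<^sup>2 * L\<^sup>2 * (w - 1) ^ m)" by (simp add: q_def power2_eq_square)
  also have "\<dots> \<le> n\<^sup>2 * w ^ m"
    using sample_size_suffices[OF w, of k] unfolding L_def m_def by (intro mult_left_mono) auto
  finally have far: "w * q * fp y \<le> n\<^sup>2" using w by simp
  have rare: "w * card (X y) \<le> n" using y by (auto simp: H_def)
  show ?thesis
    using exists_representatives[of n "row_dist n M" w "tr (y ` {..<m})" q] n row_dist_le rare far that
    unfolding X_def K_def fp_def q_def by blast
qed

text \<open>For \<open>w \<ge> 1\<close> a monomial bound is as general as a polynomial one. Closure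
  under sums, products and powers spares computing the degrees of the composed constants.\<close>

definition poly_bounded :: "(nat \<Rightarrow> nat) \<Rightarrow> bool" where
  "poly_bounded f \<longleftrightarrow> (\<exists>C N. \<forall>w\<ge>1. f w \<le> C * w ^ N)"

lemma poly_bounded_const: "poly_bounded (\<lambda>_. c)"
  unfolding poly_bounded_def by (rule exI[of _ c], rule exI[of _ 0]) simp

lemma poly_bounded_id: "poly_bounded (\<lambda>w. w)"
  unfolding poly_bounded_def by (rule exI[of _ 1], rule exI[of _ 1]) simp

lemma poly_bounded_add:
  assumes "poly_bounded f" "poly_bounded g"
  shows "poly_bounded (\<lambda>w. f w + g w)"
proof -
  obtain C N D K where f: "\<And>w. w \<ge> 1 \<Longrightarrow> f w \<le> C * w ^ N" and g: "\<And>w. w \<ge> 1 \<Longrightarrow> g w \<le> D * w ^ K"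
    using assms unfolding poly_bounded_def by blast
  have "f w + g w \<le> (C + D) * w ^ (N + K)" if w: "w \<ge> 1" for w
  proof -
    have "f w \<le> C * w ^ (N + K)"
      using f[OF w] w by (meson le_add1 le_trans mult_le_mono2 power_increasing)
    moreover have "g w \<le> D * w ^ (N + K)"
      using g[OF w] w by (meson le_add2 le_trans mult_le_mono2 power_increasing)
    ultimately show ?thesis by (simp add: add_mult_distrib)
  qed
  then show ?thesis unfolding poly_bounded_def by blast
qed

lemma poly_bounded_mult:
  assumes "poly_bounded f" "poly_bounded g"
  shows "poly_bounded (\<lambda>w. f w * g w)"
proof -
  obtain C N D K where f: "\<And>w. w \<ge> 1 \<Longrightarrow> f w \<le> C * w ^ N" and g: "\<And>w. w \<ge> 1 \<Longrightarrow> g w \<le> D * w ^ K"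
    using assms unfolding poly_bounded_def by blast
  have "f w * g w \<le> (C * D) * w ^ (N + K)" if w: "w \<ge> 1" for w
    using mult_mono[OF f[OF w] g[OF w]] by (simp add: power_add mult_ac)
  then show ?thesis unfolding poly_bounded_def by blast
qed

lemma poly_bounded_power: "poly_bounded f \<Longrightarrow> poly_bounded (\<lambda>w. f w ^ i)"
  by (induction i) (auto intro: poly_bounded_const poly_bounded_mult)

lemmas poly_bounded_intros =
  poly_bounded_const poly_bounded_id poly_bounded_add poly_bounded_mult poly_bounded_power

lemma row_clusters_or_many_copies:
  assumes s: "s \<ge> 1"
  shows "\<exists>C N. \<forall>w\<ge>1. \<forall>n M. C * w ^ N * card (copies s t A n M) < n ^ (s + t) \<longrightarrow>
    (\<exists>\<rho>. \<rho> ` {..<n} \<subseteq> {..<n} \<and> card (\<rho> ` {..<n}) \<le> C * w ^ N \<and>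
      w * (\<Sum>r<n. row_dist n M r (\<rho> r)) \<le> 3 * n\<^sup>2)"
proof -
  define k where "k = t * s ^ s + s"
  define L where "L w = (sample_size k w + 1) ^ k + 1" for w
  define b1 where "b1 w = 2 * (2 * (w * L w) ^ s) * sample_size k w ^ t" for w
  define b2 where "b2 w = 2 * w * (L w)\<^sup>2 + 1" for w
  \<comment> \<open>Bounding the sum makes one pair \<open>C\<close>, \<open>N\<close> serve both
    the factor of the copy count and the number of representatives.\<close>
  have "poly_bounded (\<lambda>w. b1 w + b2 w)"
    unfolding b1_def b2_def L_def sample_size_def by (intro poly_bounded_intros)
  then obtain C N where CN: "\<And>w. w \<ge> 1 \<Longrightarrow> b1 w + b2 w \<le> C * w ^ N"
    unfolding poly_bounded_def by blast
  have "\<exists>\<rho>. \<rho> ` {..<n} \<subseteq> {..<n} \<and> card (\<rho> ` {..<n}) \<le> C * w ^ N \<and>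
      w * (\<Sum>r<n. row_dist n M r (\<rho> r)) \<le> 3 * n\<^sup>2"
    if w: "w \<ge> 1" and few: "C * w ^ N * card (copies s t A n M) < n ^ (s + t)" for w n M
  proof -
    have n: "n > 0" using few s by (cases n) (auto simp: power_0_left)
    have "b1 w * card (copies s t A n M) \<le> C * w ^ N * card (copies s t A n M)"
      using CN[OF w] by (intro mult_right_mono) auto
    then have "b1 w * card (copies s t A n M) < n ^ (s + t)" using few by (rule le_less_trans)
    then obtain \<rho> where "\<rho> ` {..<n} \<subseteq> {..<n}" "card (\<rho> ` {..<n}) \<le> b2 w"
        "w * (\<Sum>r<n. row_dist n M r (\<rho> r)) \<le> 3 * n\<^sup>2"
      using row_clusters_or_many_copies_explicit[OF s w n, where t = t and A = A and M = M]
      unfolding b1_def b2_def L_def k_def by blast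
    then show ?thesis using CN[OF w] by (intro exI[of _ \<rho>]) auto
  qed
  then show ?thesis by (intro exI[of _ C] exI[of _ N]) simp
qed

section \<open>Nested cells\<close>

text \<open>For \<open>h \<ge> 1\<close> these are the \<open>card K / h\<close> smallest elements,
  rounded up. Rounding up makes the segment at least a \<open>1 / h\<close> fraction of any
  \<open>K\<close>, however small; in return, the upper bound \<open>2 * card K / h\<close> is
  available for \<open>h \<le> card K\<close>.\<close>

definition initial_segment :: "nat \<Rightarrow> nat set \<Rightarrow> nat set" where
  "initial_segment h K = {x \<in> K. h * rank K x < card K}"

lemma initial_segment_subset: "initial_segment h K \<subseteq> K"
  by (auto simp: initial_segment_def)

lemma initial_segment_less:
  assumes "finite K" "x \<in> initial_segment h K" "y \<in> K" "y \<notin> initial_segment h K"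
  shows "x < y"
proof (rule ccontr)
  assume "\<not> x < y"
  then have "{z \<in> K. z < y} \<subseteq> {z \<in> K. z < x}" by auto
  then have "rank K y \<le> rank K x" unfolding rank_def using assms(1) by (intro card_mono) auto
  then have "h * rank K y \<le> h * rank K x" by (rule mult_le_mono2)
  also have "\<dots> < card K" using assms(2) by (simp add: initial_segment_def)
  finally show False using assms(3,4) by (simp add: initial_segment_def)
qed

lemma card_initial_segment:
  assumes "finite K" "h \<ge> 1"
  shows "card (initial_segment h K) = (card K + h - 1) div h"
proof -
  define N where "N = card K"
  have iff: "h * i < N \<longleftrightarrow> i < (N + h - 1) div h" for i
  proof -
    have "i < (N + h - 1) div h \<longleftrightarrow> Suc i * h \<le> N + h - 1"
      using assms(2) by (simp add: less_eq_div_iff_mult_less_eq flip: Suc_le_eq)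
    also have "\<dots> \<longleftrightarrow> h * i < N" using assms(2) by (auto simp: mult.commute)
    finally show ?thesis by simp
  qed
  have "rank K ` initial_segment h K = {i. i < N \<and> h * i < N}"
    using bij_betw_rank[OF assms(1)] unfolding initial_segment_def N_def bij_betw_def by auto
  also have "\<dots> = {i. h * i < N}"
  proof -
    have "i < N" if "h * i < N" for i
    proof -
      have "1 * i \<le> h * i" using assms(2) by (intro mult_right_mono) auto
      then show ?thesis using that by linarith
    qed
    then show ?thesis by auto
  qed
  also have "\<dots> = {..<(N + h - 1) div h}" using iff by auto
  finally have "card (rank K ` initial_segment h K) = (N + h - 1) div h" by simp
  moreover have "inj_on (rank K) (initial_segment h K)"
    using inj_on_rank[OF assms(1)] initial_segment_subset by (rule inj_on_subset)
  ultimately show ?thesis by (simp add: card_image N_def)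
qed

lemma card_le_initial_segment:
  assumes "finite K" "h \<ge> 1"
  shows "card K \<le> h * card (initial_segment h K)"
proof -
  have "card K + h - 1 < h * ((card K + h - 1) div h) + h"
    using assms(2) dividend_less_times_div[of h "card K + h - 1"] by simp
  then show ?thesis using assms by (simp add: card_initial_segment)
qed

lemma card_initial_segment_le:
  assumes "finite K" "h \<ge> 1" "h \<le> card K"
  shows "h * card (initial_segment h K) \<le> 2 * card K"
proof -
  have "h * ((card K + h - 1) div h) \<le> card K + h - 1" by (rule times_div_less_eq_dividend)
  also have "\<dots> \<le> 2 * card K" using assms(3) by linarith
  finally show ?thesis using assms by (simp only: card_initial_segment)
qed

text \<open>Each level refines the previous one by cutting after the initial segment of every cell, so that
  a point outside its own initial segment has this whole segment, and one of the new cuts, to its left.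
  Points further right then have all their finer cells to the right of that cut.\<close>

definition cell :: "nat \<Rightarrow> (nat \<Rightarrow> 'l) \<Rightarrow> nat set \<Rightarrow> nat \<Rightarrow> nat set" where
  "cell n lab B c = {x \<in> {..<n}. lab x = lab c \<and> (\<forall>b\<in>B. b < x \<longleftrightarrow> b < c)}"

primrec cuts :: "nat \<Rightarrow> (nat \<Rightarrow> 'l) \<Rightarrow> nat \<Rightarrow> nat \<Rightarrow> nat set" where
  "cuts n lab h 0 = {}"
| "cuts n lab h (Suc k) =
     cuts n lab h k \<union> (\<lambda>c. Max (initial_segment h (cell n lab (cuts n lab h k) c))) ` {..<n}"

lemma finite_cell: "finite (cell n lab B c)"
  by (simp add: cell_def)

lemma cell_subset: "cell n lab B c \<subseteq> {..<n}"
  by (auto simp: cell_def)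

lemma mem_cell: "c < n \<Longrightarrow> c \<in> cell n lab B c"
  by (simp add: cell_def)

lemma cell_eq: "x \<in> cell n lab B c \<Longrightarrow> cell n lab B x = cell n lab B c"
  by (auto simp: cell_def)

lemma cells_disjoint:
  "cell n lab B c \<noteq> cell n lab B c' \<Longrightarrow> cell n lab B c \<inter> cell n lab B c' = {}"
  by (metis cell_eq disjoint_iff)

text \<open>A cell is determined by its label and the set of cuts below its points. These sets of
  cuts form a chain, so they are told apart by their sizes and there are at most
  \<open>card B + 1\<close> of them.\<close>

lemma card_cells_le:
  fixes lab :: "nat \<Rightarrow> 'l"
  assumes "card (lab ` {..<n}) \<le> T" "finite B"
  shows "card (cell n lab B ` {..<n}) \<le> T * (card B + 1)"
proof -
  define ini where "ini = (\<lambda>c. {b \<in> B. b < c}) ` {..<n}"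
  have fini: "finite ini" by (simp add: ini_def)
  have "card ini \<le> card B + 1"
  proof -
    have "inj_on card ini"
    proof (rule inj_onI)
      fix P P' assume P: "P \<in> ini" "P' \<in> ini" "card P = card P'"
      then obtain c c' where c: "P = {b \<in> B. b < c}" "P' = {b \<in> B. b < c'}" by (auto simp: ini_def)
      have "P \<subseteq> P' \<or> P' \<subseteq> P" unfolding c by auto
      moreover have "finite P" "finite P'" using assms(2) c by auto
      ultimately show "P = P'" using P(3) card_subset_eq by metis
    qed
    moreover have "card ` ini \<subseteq> {..card B}"
      using assms(2) by (auto simp: ini_def intro!: card_mono)
    ultimately show ?thesis using card_inj_on_le[of card ini "{..card B}"] by simp
  qed
  moreover have "cell n lab B ` {..<n} \<subseteq>
      (\<lambda>(l, P). {x \<in> {..<n}. lab x = l \<and> (\<forall>b\<in>B. b < x \<longleftrightarrow> b \<in> P)}) ` (lab ` {..<n} \<times> ini)"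
  proof
    fix K assume "K \<in> cell n lab B ` {..<n}"
    then obtain c where c: "c < n" "K = cell n lab B c" by auto
    show "K \<in> (\<lambda>(l, P). {x \<in> {..<n}. lab x = l \<and> (\<forall>b\<in>B. b < x \<longleftrightarrow> b \<in> P)}) ` (lab ` {..<n} \<times> ini)"
      by (rule image_eqI[where x = "(lab c, {b \<in> B. b < c})"])
        (use c in \<open>auto simp: cell_def ini_def\<close>)
  qed
  then have "card (cell n lab B ` {..<n}) \<le> card (lab ` {..<n} \<times> ini)"
    by (rule surj_card_le[rotated]) (simp add: fini)
  moreover have "card (lab ` {..<n} \<times> ini) = card (lab ` {..<n}) * card ini"
    by (rule card_cartesian_product)
  ultimately show ?thesis using mult_le_mono[OF assms(1), of "card ini" "card B + 1"] by linarith
qed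

lemma finite_cuts: "finite (cuts n lab h k)"
  by (induction k) auto

lemma cuts_mono: "k \<le> k' \<Longrightarrow> cuts n lab h k \<subseteq> cuts n lab h k'"
  by (rule lift_Suc_mono_le[where f = "cuts n lab h"]) (simp_all only: cuts.simps(2) Un_upper1)

text \<open>Each level adds at most one cut per cell, hence at most \<open>T * (card B + 1)\<close>
  cuts to the previous set \<open>B\<close>; thus \<open>card B + 1\<close> grows by a factor of at
  most \<open>T + 1\<close>.\<close>

lemma card_cuts_le:
  assumes "card (lab ` {..<n}) \<le> T"
  shows "card (cuts n lab h k) + 1 \<le> (T + 1) ^ k"
proof (induction k)
  case (Suc k)
  let ?B = "cuts n lab h k"
  have "(\<lambda>c. Max (initial_segment h (cell n lab ?B c))) ` {..<n} =
      (\<lambda>K. Max (initial_segment h K)) ` cell n lab ?B ` {..<n}" by (simp add: image_image)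
  then have "card ((\<lambda>c. Max (initial_segment h (cell n lab ?B c))) ` {..<n}) \<le>
      card (cell n lab ?B ` {..<n})"
    by (simp add: card_image_le)
  also have "\<dots> \<le> T * (card ?B + 1)" by (rule card_cells_le[OF assms finite_cuts])
  finally have "card (cuts n lab h (Suc k)) \<le> card ?B + T * (card ?B + 1)"
    using card_Un_le[of ?B "(\<lambda>c. Max (initial_segment h (cell n lab ?B c))) ` {..<n}"] by simp
  then have "card (cuts n lab h (Suc k)) + 1 \<le> (T + 1) * (card ?B + 1)" by simp
  also have "\<dots> \<le> (T + 1) * (T + 1) ^ k" using Suc.IH by (rule mult_left_mono) simp
  finally show ?case by simp
qed simp

lemma initial_segments_ordered:
  fixes lab :: "nat \<Rightarrow> 'l" and n h :: nat
  defines "cl k c \<equiv> cell n lab (cuts n lab h k) c"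
  assumes c: "c < n" "c < c'" "c \<notin> initial_segment h (cl k c)" and k: "k < k'"
    and x: "x \<in> initial_segment h (cl k c)" and x': "x' \<in> cl k' c'"
  shows "x < x'"
proof -
  define b where "b = Max (initial_segment h (cl k c))"
  have fin: "finite (cl k c)" by (simp add: cl_def finite_cell)
  have fs: "finite (initial_segment h (cl k c))"
    using initial_segment_subset fin by (rule finite_subset)
  have "b \<in> initial_segment h (cl k c)" unfolding b_def using fs x by (intro Max_in) auto
  moreover have "c \<in> cl k c" unfolding cl_def by (rule mem_cell[OF c(1)])
  ultimately have "b < c" using initial_segment_less[OF fin] c(3) by blast
  \<comment> \<open>As \<open>Suc k \<le> k'\<close>, the cut \<open>b\<close> is still present at
    level \<open>k'\<close>, so the whole cell of \<open>c'\<close> lies on the same side of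
    \<open>b\<close> as \<open>c'\<close>.\<close>
  moreover have "b \<in> cuts n lab h (Suc k)" using c(1) by (auto simp: b_def cl_def)
  then have "b \<in> cuts n lab h k'" using cuts_mono[of "Suc k" k' n lab h] k by auto
  ultimately have "b < x'" using x' c(2) by (auto simp: cl_def cell_def)
  moreover have "x \<le> b" unfolding b_def using fs x by (rule Max_ge)
  ultimately show ?thesis by simp
qed

text \<open>The initial segments of large cells have at most \<open>2 * n / h\<close> points in
  total; the at most \<open>Q\<close> small cells have fewer than \<open>n / (h * Q)\<close> points
  each, so at most \<open>n / h\<close> in total. Scaling the size threshold by \<open>Q\<close>
  keeps the loss independent of \<open>Q\<close>.\<close>

lemma card_removed_le:
  fixes lab :: "nat \<Rightarrow> 'l"
  assumes cells: "card (cell n lab B ` {..<n}) \<le> Q" and h: "h \<ge> 1" and n: "h\<^sup>2 * Q \<le> n"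
  defines "cl \<equiv> cell n lab B"
  defines "Z \<equiv> {c \<in> {..<n}. c \<in> initial_segment h (cl c) \<or> card (cl c) * (h * Q) < n}"
  shows "h * card Z \<le> 3 * n"
proof (cases "Q = 0")
  case True
  then have "cell n lab B ` {..<n} = {}" using cells by simp
  then show ?thesis by (simp add: Z_def)
next
  case False
  define \<K> where "\<K> = cl ` {..<n}"
  define Sm where "Sm = {K \<in> \<K>. card K * (h * Q) < n}"
  define La where "La = {K \<in> \<K>. n \<le> card K * (h * Q)}"
  have fK: "finite \<K>" "finite Sm" "finite La" by (auto simp: \<K>_def Sm_def La_def)
  have fin: "finite K" if "K \<in> \<K>" for K using that by (auto simp: \<K>_def cl_def finite_cell)
  have disj: "K \<inter> K' = {}" if KK: "K \<in> \<K>" "K' \<in> \<K>" "K \<noteq> K'" for K K'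
  proof -
    obtain c c' where "K = cell n lab B c" "K' = cell n lab B c'"
      using KK by (auto simp: \<K>_def cl_def)
    then show ?thesis using KK(3) cells_disjoint[of n lab B c c'] by blast
  qed
  have sumK: "(\<Sum>K\<in>\<K>. card K) \<le> n"
  proof -
    have "(\<Sum>K\<in>\<K>. card K) = card (\<Union>K\<in>\<K>. K)"
      using fK fin disj by (intro card_UN_disjoint[symmetric]) auto
    also have "\<dots> \<le> card {..<n}"
      by (intro card_mono) (auto simp: \<K>_def cl_def cell_def)
    finally show ?thesis by simp
  qed
  have "Z \<subseteq> (\<Union>K\<in>La. initial_segment h K) \<union> (\<Union>K\<in>Sm. K)"
  proof
    fix c assume c: "c \<in> Z"
    then have "c < n" by (simp add: Z_def)
    then have "cl c \<in> \<K>" "c \<in> cl c" by (auto simp: \<K>_def cl_def mem_cell)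
    then show "c \<in> (\<Union>K\<in>La. initial_segment h K) \<union> (\<Union>K\<in>Sm. K)"
      using c by (cases "card (cl c) * (h * Q) < n") (auto simp: Z_def La_def Sm_def not_less)
  qed
  then have "card Z \<le> card ((\<Union>K\<in>La. initial_segment h K) \<union> (\<Union>K\<in>Sm. K))"
    using fK fin
    by (intro card_mono) (auto simp: La_def Sm_def initial_segment_def intro!: finite_UN_I)
  also have "\<dots> \<le> card (\<Union>K\<in>La. initial_segment h K) + card (\<Union>K\<in>Sm. K)" by (rule card_Un_le)
  also have "\<dots> \<le> (\<Sum>K\<in>La. card (initial_segment h K)) + (\<Sum>K\<in>Sm. card K)"
    by (intro add_mono card_UN_le fK)
  finally have "h * card Z \<le> (\<Sum>K\<in>La. h * card (initial_segment h K)) + (\<Sum>K\<in>Sm. h * card K)"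
    by (simp add: sum_distrib_left[symmetric] add_mult_distrib2[symmetric])
  also have "\<dots> \<le> 2 * n + n"
  proof (rule add_mono)
    have "h * card (initial_segment h K) \<le> 2 * card K" if K: "K \<in> La" for K
    proof -
      \<comment> \<open>A large cell has at least \<open>n / (h * Q)\<close>, hence at least
        \<open>h\<close> elements, so rounding up its segment costs at most a factor 2.\<close>
      have "h * (h * Q) \<le> n" using n by (simp add: power2_eq_square mult.assoc)
      also have "\<dots> \<le> card K * (h * Q)" using K by (simp add: La_def)
      finally have "h * (h * Q) \<le> card K * (h * Q)" .
      then have "h \<le> card K" using h False by simp
      then show ?thesis using K fin h by (intro card_initial_segment_le) (auto simp: La_def)
    qed
    then have "(\<Sum>K\<in>La. h * card (initial_segment h K)) \<le> (\<Sum>K\<in>La. 2 * card K)" by (rule sum_mono)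
    also have "\<dots> \<le> (\<Sum>K\<in>\<K>. 2 * card K)" using fK by (intro sum_mono2) (auto simp: La_def)
    also have "\<dots> \<le> 2 * n" using sumK by (simp add: sum_distrib_left[symmetric])
    finally show "(\<Sum>K\<in>La. h * card (initial_segment h K)) \<le> 2 * n" .
    have "Q * (\<Sum>K\<in>Sm. h * card K) = (\<Sum>K\<in>Sm. card K * (h * Q))"
      by (simp add: sum_distrib_left mult_ac)
    also have "\<dots> \<le> (\<Sum>K\<in>Sm. n)" by (rule sum_mono) (simp add: Sm_def)
    also have "\<dots> \<le> Q * n"
    proof -
      have "card Sm \<le> card \<K>" using fK by (intro card_mono) (auto simp: Sm_def)
      then show ?thesis using cells by (simp add: \<K>_def cl_def)
    qed
    finally show "(\<Sum>K\<in>Sm. h * card K) \<le> n" using False by simp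
  qed
  finally show ?thesis by simp
qed

text \<open>The interface of one axis, with the cuts hidden, to be interpreted once for rows and
  once for columns. \<open>d\<close> counts the levels; the value \<open>s + t\<close> will be taken
  for both axes, so that they share \<open>Q\<close> and the bound on \<open>Z\<close>.\<close>

locale nested_cells =
  fixes n :: nat and lab :: "nat \<Rightarrow> 'l" and h Q d :: nat
    and Z :: "nat set" and cl :: "nat \<Rightarrow> nat \<Rightarrow> nat set"
  assumes removed_subset: "Z \<subseteq> {..<n}"
    and card_removed: "h * card Z \<le> 3 * d * n"
    and cl_subset: "cl k c \<subseteq> {..<n}"
    and mem_cl: "c < n \<Longrightarrow> c \<in> cl k c"
    and cl_eq: "x \<in> cl k c \<Longrightarrow> cl k x = cl k c"
    and lab_eq: "x \<in> cl k c \<Longrightarrow> lab x = lab c"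
    and cl_large: "k < d \<Longrightarrow> c \<in> {..<n} - Z \<Longrightarrow> n \<le> card (cl k c) * (h * Q)"
    and segments_ordered: "k < k' \<Longrightarrow> k' < d \<Longrightarrow> c \<in> {..<n} - Z \<Longrightarrow> c < c' \<Longrightarrow>
       x \<in> initial_segment h (cl k c) \<Longrightarrow> x' \<in> cl k' c' \<Longrightarrow> x < x'"

text \<open>Points are removed at each level \<open>k < d\<close>. Level \<open>k\<close> has at
  most \<open>(T + 1) ^ (k + 1)\<close> cells, so \<open>(T + 1) ^ d\<close> serves for all levels,
  and the loss is \<open>d\<close> times that of one level.\<close>

lemma exists_nested_cells:
  fixes lab :: "nat \<Rightarrow> 'l"
  assumes T: "card (lab ` {..<n}) \<le> T" and h: "h \<ge> 1" and n: "h\<^sup>2 * (T + 1) ^ d \<le> n"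
  obtains Z cl where "nested_cells n lab h ((T + 1) ^ d) d Z cl"
proof -
  define cl where "cl k c = cell n lab (cuts n lab h k) c" for k c
  define Q where "Q = (T + 1) ^ d"
  define Zk where "Zk k = {c \<in> {..<n}. c \<in> initial_segment h (cl k c) \<or> card (cl k c) * (h * Q) < n}" for k
  define Z where "Z = (\<Union>k<d. Zk k)"
  have Zk: "h * card (Zk k) \<le> 3 * n" if k: "k < d" for k
  proof -
    have "card (cell n lab (cuts n lab h k) ` {..<n}) \<le> T * (card (cuts n lab h k) + 1)"
      by (rule card_cells_le[OF T finite_cuts])
    also have "\<dots> \<le> (T + 1) * (T + 1) ^ k" using card_cuts_le[OF T] by (intro mult_mono) auto
    also have "\<dots> \<le> Q" unfolding Q_def using k power_increasing[of "Suc k" d "T + 1"] by simp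
    finally show ?thesis
      using card_removed_le[of n lab "cuts n lab h k" Q h] h n unfolding Zk_def cl_def Q_def by simp
  qed
  have "card Z \<le> (\<Sum>k<d. card (Zk k))" unfolding Z_def by (rule card_UN_le) simp
  then have "h * card Z \<le> (\<Sum>k<d. h * card (Zk k))" by (simp add: sum_distrib_left[symmetric])
  also have "\<dots> \<le> (\<Sum>k<d. 3 * n)" using Zk by (intro sum_mono) auto
  finally have Z: "h * card Z \<le> 3 * d * n" by simp
  have "nested_cells n lab h Q d Z cl"
  proof
    show "Z \<subseteq> {..<n}" by (auto simp: Z_def Zk_def)
    show "h * card Z \<le> 3 * d * n" by (rule Z)
    show "cl k c \<subseteq> {..<n}" for k c unfolding cl_def by (rule cell_subset)
    show "c \<in> cl k c" if "c < n" for k c unfolding cl_def using that by (rule mem_cell)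
    show "cl k x = cl k c" if "x \<in> cl k c" for k c x using that unfolding cl_def by (rule cell_eq)
    show "lab x = lab c" if "x \<in> cl k c" for k c x using that by (simp add: cl_def cell_def)
    show "n \<le> card (cl k c) * (h * Q)" if "k < d" "c \<in> {..<n} - Z" for k c
      using that by (auto simp: Z_def Zk_def not_less)
    show "x < x'" if "k < k'" "k' < d" "c \<in> {..<n} - Z" "c < c'"
      "x \<in> initial_segment h (cl k c)" "x' \<in> cl k' c'" for k k' c c' x x'
    proof -
      have "k < d" using that by simp
      then have "c \<notin> initial_segment h (cl k c)" using that(3) by (auto simp: Z_def Zk_def)
      then show ?thesis
        using initial_segments_ordered[of c n c' h lab k k' x x'] that unfolding cl_def by auto
    qed
  qed
  then show ?thesis using that unfolding Q_def by blast
qed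

section \<open>Copies from homogeneous blocks\<close>

lemma rank_image_strict_mono:
  assumes "strict_mono_on {..<s} x" "i < s"
  shows "rank (x ` {..<s}) (x i) = i"
proof -
  have "{y \<in> x ` {..<s}. y < x i} = x ` {..<i}"
  proof (intro equalityI subsetI)
    fix y assume "y \<in> {y \<in> x ` {..<s}. y < x i}"
    then obtain j where j: "j < s" "y = x j" "x j < x i" by auto
    then have "j < i" using strict_mono_on_less[OF assms(1), of j i] assms(2) by auto
    then show "y \<in> x ` {..<i}" using j by auto
  next
    fix y assume "y \<in> x ` {..<i}"
    then show "y \<in> {y \<in> x ` {..<s}. y < x i}" using assms strict_mono_onD[OF assms(1)] by auto
  qed
  moreover have "inj_on x {..<i}"
    using strict_mono_on_imp_inj_on[OF assms(1)] by (rule inj_on_subset) (use assms in auto)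
  ultimately show ?thesis by (simp add: rank_def card_image)
qed

text \<open>An increasing tuple is recovered from its set of values, its \<open>i\<close>-th entry
  being the element of rank \<open>i\<close>. Distinct increasing transversals therefore yield
  distinct copies.\<close>

lemma inj_on_image_strict_mono:
  "inj_on (\<lambda>x. x ` {..<s}) {x \<in> extensional {..<s}. strict_mono_on {..<s} (x :: nat \<Rightarrow> nat)}"
proof (rule inj_onI)
  fix x y :: "nat \<Rightarrow> nat"
  assume x: "x \<in> {x \<in> extensional {..<s}. strict_mono_on {..<s} x}"
    and y: "y \<in> {x \<in> extensional {..<s}. strict_mono_on {..<s} x}"
    and eq: "x ` {..<s} = y ` {..<s}"
  have "x i = y i" if i: "i \<in> {..<s}" for i
  proof (rule inj_onD[OF inj_on_rank[of "x ` {..<s}"]])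
    show "rank (x ` {..<s}) (x i) = rank (x ` {..<s}) (y i)"
      using rank_image_strict_mono[of s x i] rank_image_strict_mono[of s y i] x y i eq by simp
  qed (use i eq in auto)
  then show "x = y" using x y by (auto intro: extensionalityI)
qed

text \<open>For independent uniform choices from the blocks, the pair \<open>(x i, y j)\<close> is
  uniform on \<open>D i \<times> E j\<close>; the remaining coordinates are free and cancel.\<close>

lemma card_PiE_pair_in_le:
  assumes "finite I" "finite J" "\<And>i. i \<in> I \<Longrightarrow> finite (D i)" "\<And>j. j \<in> J \<Longrightarrow> finite (E j)"
    and i: "i \<in> I" and j: "j \<in> J"
    and g: "g * card (B \<inter> D i \<times> E j) \<le> card (D i) * card (E j)"
  shows "g * card {(x, y) \<in> PiE I D \<times> PiE J E. (x i, y j) \<in> B} \<le> card (PiE I D \<times> PiE J E)"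
proof -
  define I' where "I' = I - {i}"
  define J' where "J' = J - {j}"
  have I': "finite I'" "I = insert i I'" "i \<notin> I'" using assms i by (auto simp: I'_def)
  have J': "finite J'" "J = insert j J'" "j \<notin> J'" using assms j by (auto simp: J'_def)
  have fB: "finite (B \<inter> D i \<times> E j)" using assms by auto
  have "{(x, y) \<in> PiE I D \<times> PiE J E. (x i, y j) \<in> B} \<subseteq>
      (\<lambda>((a, b), x, y). (x(i := a), y(j := b))) ` ((B \<inter> D i \<times> E j) \<times> PiE I' D \<times> PiE J' E)"
  proof
    fix p assume "p \<in> {(x, y) \<in> PiE I D \<times> PiE J E. (x i, y j) \<in> B}"
    then obtain x y where p: "p = (x, y)" "x \<in> PiE I D" "y \<in> PiE J E" "(x i, y j) \<in> B" by auto
    have "x(i := undefined) \<in> PiE I' D" "y(j := undefined) \<in> PiE J' E"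
      using p I' J' by (auto simp: PiE_iff extensional_def)
    moreover have "x i \<in> D i" "y j \<in> E j" using p i j by auto
    ultimately show "p \<in> (\<lambda>((a, b), x, y). (x(i := a), y(j := b))) `
        ((B \<inter> D i \<times> E j) \<times> PiE I' D \<times> PiE J' E)"
      using p(1,4) by (intro image_eqI[where x = "((x i, y j), x(i := undefined), y(j := undefined))"]) auto
  qed
  then have "card {(x, y) \<in> PiE I D \<times> PiE J E. (x i, y j) \<in> B} \<le>
      card ((B \<inter> D i \<times> E j) \<times> PiE I' D \<times> PiE J' E)"
    using fB I'(1) J'(1) assms(3,4)
    by (intro surj_card_le) (auto simp: I'_def J'_def intro!: finite_PiE finite_cartesian_product)
  also have "\<dots> = card (B \<inter> D i \<times> E j) * ((\<Prod>i\<in>I'. card (D i)) * (\<Prod>j\<in>J'. card (E j)))"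
    using I' J' by (simp add: card_cartesian_product card_PiE)
  finally have "g * card {(x, y) \<in> PiE I D \<times> PiE J E. (x i, y j) \<in> B} \<le>
      g * (card (B \<inter> D i \<times> E j) * ((\<Prod>i\<in>I'. card (D i)) * (\<Prod>j\<in>J'. card (E j))))"
    by (rule mult_left_mono) simp
  also have "\<dots> = g * card (B \<inter> D i \<times> E j) * ((\<Prod>i\<in>I'. card (D i)) * (\<Prod>j\<in>J'. card (E j)))"
    by (simp only: mult.assoc)
  also have "\<dots> \<le> card (D i) * card (E j) * ((\<Prod>i\<in>I'. card (D i)) * (\<Prod>j\<in>J'. card (E j)))"
    using g by (rule mult_right_mono) simp
  also have "\<dots> = card (PiE I D \<times> PiE J E)"
    using I' J' by (simp add: card_cartesian_product card_PiE mult_ac)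
  finally show ?thesis .
qed

text \<open>Each of the \<open>s * t\<close> coordinate pairs falls into \<open>B\<close> with
  probability at most \<open>1 / (2 * s * t)\<close>, so at least half of the transversals avoid
  \<open>B\<close>. The order of the blocks makes transversals increasing, so ranks agree with block
  indices.\<close>

lemma card_copies_ge_of_blocks:
  assumes s: "s \<ge> 1" and t: "t \<ge> 1"
    and D: "\<And>i. i < s \<Longrightarrow> D i \<subseteq> {..<n}" and E: "\<And>j. j < t \<Longrightarrow> E j \<subseteq> {..<n}"
    and Dord: "\<And>i i' x x'. i < i' \<Longrightarrow> i' < s \<Longrightarrow> x \<in> D i \<Longrightarrow> x' \<in> D i' \<Longrightarrow> x < x'"
    and Eord: "\<And>j j' y y'. j < j' \<Longrightarrow> j' < t \<Longrightarrow> y \<in> E j \<Longrightarrow> y' \<in> E j' \<Longrightarrow> y < y'"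
    and few: "\<And>i j. i < s \<Longrightarrow> j < t \<Longrightarrow> 2 * s * t * card (B \<inter> D i \<times> E j) \<le> card (D i) * card (E j)"
    and good: "\<And>i j x y. i < s \<Longrightarrow> j < t \<Longrightarrow> x \<in> D i \<Longrightarrow> y \<in> E j \<Longrightarrow> (x, y) \<notin> B \<Longrightarrow> M x y = A i j"
  shows "(\<Prod>i<s. card (D i)) * (\<Prod>j<t. card (E j)) \<le> 2 * card (copies s t A n M)"
proof -
  define P where "P = PiE {..<s} D \<times> PiE {..<t} E"
  define Bd where "Bd i j = {(x, y) \<in> P. (x i, y j) \<in> B}" for i j
  define U where "U = (\<Union>i<s. \<Union>j<t. Bd i j)"
  have fD: "finite (D i)" if "i < s" for i using D[OF that] by (rule finite_subset) simp
  have fE: "finite (E j)" if "j < t" for j using E[OF that] by (rule finite_subset) simp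
  have fP: "finite P" unfolding P_def using fD fE by (auto intro!: finite_PiE)
  have Bd: "2 * s * t * card (Bd i j) \<le> card P" if "i < s" "j < t" for i j
    unfolding Bd_def P_def using few[OF that] that fD fE
    by (intro card_PiE_pair_in_le) auto
  have "card U \<le> (\<Sum>i<s. card (\<Union>j<t. Bd i j))" unfolding U_def by (rule card_UN_le) simp
  also have "\<dots> \<le> (\<Sum>i<s. \<Sum>j<t. card (Bd i j))" by (intro sum_mono card_UN_le) simp
  finally have "2 * s * t * card U \<le> 2 * s * t * (\<Sum>i<s. \<Sum>j<t. card (Bd i j))"
    by (rule mult_left_mono) simp
  also have "\<dots> = (\<Sum>i<s. \<Sum>j<t. 2 * s * t * card (Bd i j))" by (simp add: sum_distrib_left)
  also have "\<dots> \<le> (\<Sum>i<s. \<Sum>j<t. card P)" using Bd by (intro sum_mono) auto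
  also have "\<dots> = s * t * card P" by simp
  finally have "s * t * (2 * card U) \<le> s * t * card P" by (simp add: mult_ac)
  then have U: "2 * card U \<le> card P" using s t by simp
  have "U \<subseteq> P" by (auto simp: U_def Bd_def)
  then have "card (P - U) = card P - card U" using fP by (intro card_Diff_subset) (auto intro: finite_subset)
  then have G: "card P \<le> 2 * card (P - U)" using U by simp
  have mono: "strict_mono_on {..<s} x" if "x \<in> PiE {..<s} D" for x
    using that Dord by (intro strict_mono_onI) (meson PiE_mem lessThan_iff)
  have mono': "strict_mono_on {..<t} y" if "y \<in> PiE {..<t} E" for y
    using that Eord by (intro strict_mono_onI) (meson PiE_mem lessThan_iff)
  have "card (P - U) \<le> card (copies s t A n M)"
  proof (rule card_inj_on_le[where f = "\<lambda>(x, y). (x ` {..<s}, y ` {..<t})"])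
    show "finite (copies s t A n M)" by (rule finite_copies)
    show "inj_on (\<lambda>(x, y). (x ` {..<s}, y ` {..<t})) (P - U)"
    proof (rule inj_onI)
      fix p q
      assume pq: "p \<in> P - U" "q \<in> P - U"
        "(case p of (x, y) \<Rightarrow> (x ` {..<s}, y ` {..<t})) = (case q of (x, y) \<Rightarrow> (x ` {..<s}, y ` {..<t}))"
      obtain x y u v where xy: "p = (x, y)" "q = (u, v)" by (metis surj_pair)
      have mem: "x \<in> PiE {..<s} D" "u \<in> PiE {..<s} D" "y \<in> PiE {..<t} E" "v \<in> PiE {..<t} E"
        using pq xy by (auto simp: P_def)
      have "x = u"
        using inj_on_image_strict_mono[of s] mono mem pq(3) xy
        by (auto simp: inj_on_def PiE_def)
      moreover have "y = v"
        using inj_on_image_strict_mono[of t] mono' mem pq(3) xy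
        by (auto simp: inj_on_def PiE_def)
      ultimately show "p = q" using xy by simp
    qed
    show "(\<lambda>(x, y). (x ` {..<s}, y ` {..<t})) ` (P - U) \<subseteq> copies s t A n M"
    proof
      fix p assume "p \<in> (\<lambda>(x, y). (x ` {..<s}, y ` {..<t})) ` (P - U)"
      then obtain x y where p: "p = (x ` {..<s}, y ` {..<t})" "(x, y) \<in> P" "(x, y) \<notin> U" by auto
      have x: "x \<in> PiE {..<s} D" and y: "y \<in> PiE {..<t} E" using p by (auto simp: P_def)
      note mx = mono[OF x] and my = mono'[OF y]
      have "M (x i) (y j) = A i j" if "i < s" "j < t" for i j
      proof (rule good[OF that])
        show "(x i, y j) \<notin> B" using p(2,3) that by (auto simp: U_def Bd_def)
      qed (use x y that in auto)
      moreover have "x ` {..<s} \<subseteq> {..<n}" "y ` {..<t} \<subseteq> {..<n}"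
        using PiE_mem[OF x] PiE_mem[OF y] D E by blast+
      moreover have "card (x ` {..<s}) = s" "card (y ` {..<t}) = t"
        using strict_mono_on_imp_inj_on[OF mx] strict_mono_on_imp_inj_on[OF my] by (simp_all add: card_image)
      ultimately show "p \<in> copies s t A n M"
        unfolding p(1) copies_def mem_Collect_eq is_copy_iff_rank
        using rank_image_strict_mono[OF mx] rank_image_strict_mono[OF my] by auto
    qed
  qed
  then have "card P \<le> 2 * card (copies s t A n M)" using G by simp
  then show ?thesis by (simp add: P_def card_cartesian_product card_PiE)
qed

text \<open>Disjointness enters here: a point of \<open>K\<close> lies in at most one member of
  \<open>S\<close>, so hitting all members would inject \<open>S\<close> into
  \<open>K\<close>.\<close>

lemma exists_copy_avoiding:
  assumes S: "S \<subseteq> copies s t A n M" "pairwise_disjoint_copies S" and K: "finite K" "card K < card S"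
  obtains X where "X \<in> S" "positions X \<inter> K = {}"
proof -
  have "\<exists>X\<in>S. positions X \<inter> K = {}"
  proof (rule ccontr)
    assume "\<not> (\<exists>X\<in>S. positions X \<inter> K = {})"
    then have "\<forall>X\<in>S. \<exists>p. p \<in> positions X \<inter> K" by blast
    then obtain f where f: "\<And>X. X \<in> S \<Longrightarrow> f X \<in> positions X \<inter> K" by metis
    have "inj_on f S"
    proof (rule inj_onI)
      fix X Y assume XY: "X \<in> S" "Y \<in> S" "f X = f Y"
      then have "positions X \<inter> positions Y \<noteq> {}" using f[of X] f[of Y] by auto
      then show "X = Y" using S(2) XY unfolding pairwise_disjoint_copies_def by blast
    qed
    then have "card S \<le> card K" using f K by (intro card_inj_on_le[of f]) auto
    then show False using K by simp
  qed
  then show ?thesis using that by blast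
qed

text \<open>A product of two cells is charged to the bad entries in the product of their initial
  segments, each of which receives a charge of at most \<open>g * h\<^sup>2\<close>. Products of
  segments from different pairs of cells are disjoint, so no entry is charged twice, however many
  cells there are.\<close>

lemma card_bad_blocks_le:
  fixes cl cl' :: "nat \<Rightarrow> nat set"
  assumes h: "h \<ge> 1" and B: "finite B"
    and cl: "\<And>c. cl c \<subseteq> {..<n}" "\<And>c. c < n \<Longrightarrow> c \<in> cl c" "\<And>c x. x \<in> cl c \<Longrightarrow> cl x = cl c"
    and cl': "\<And>c. cl' c \<subseteq> {..<n}" "\<And>c. c < n \<Longrightarrow> c \<in> cl' c" "\<And>c x. x \<in> cl' c \<Longrightarrow> cl' x = cl' c"
  defines "D r \<equiv> initial_segment h (cl r)" and "E c \<equiv> initial_segment h (cl' c)"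
  shows "card {(r, c) \<in> {..<n} \<times> {..<n}. card (D r) * card (E c) < g * card (B \<inter> D r \<times> E c)} \<le>
    g * h\<^sup>2 * card B"
proof -
  define seg where "seg = initial_segment h"
  define \<K> where "\<K> = {(K, K') \<in> cl ` {..<n} \<times> cl' ` {..<n}.
      card (seg K) * card (seg K') < g * card (B \<inter> seg K \<times> seg K')}"
  have f\<K>: "finite \<K>" unfolding \<K>_def by (rule finite_subset[of _ "cl ` {..<n} \<times> cl' ` {..<n}"]) auto
  have fcl: "finite (cl c)" "finite (cl' c)" for c
    using finite_subset[OF cl(1)] finite_subset[OF cl'(1)] by simp_all
  have seg: "seg K \<subseteq> K" for K by (simp add: seg_def initial_segment_subset)
  have "{(r, c) \<in> {..<n} \<times> {..<n}. card (D r) * card (E c) < g * card (B \<inter> D r \<times> E c)} \<subseteq>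
      (\<Union>p\<in>\<K>. fst p \<times> snd p)"
  proof
    fix p assume "p \<in> {(r, c) \<in> {..<n} \<times> {..<n}. card (D r) * card (E c) < g * card (B \<inter> D r \<times> E c)}"
    then obtain r c where p: "p = (r, c)" "r < n" "c < n"
      "card (D r) * card (E c) < g * card (B \<inter> D r \<times> E c)" by auto
    have "(cl r, cl' c) \<in> \<K>" using p by (auto simp: \<K>_def seg_def D_def E_def)
    moreover have "p \<in> cl r \<times> cl' c" using p cl(2) cl'(2) by auto
    ultimately show "p \<in> (\<Union>p\<in>\<K>. fst p \<times> snd p)" by force
  qed
  then have "card {(r, c) \<in> {..<n} \<times> {..<n}. card (D r) * card (E c) < g * card (B \<inter> D r \<times> E c)} \<le>
      card (\<Union>p\<in>\<K>. fst p \<times> snd p)"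
    using f\<K> fcl by (intro card_mono) (auto simp: \<K>_def intro!: finite_UN_I)
  also have "\<dots> \<le> (\<Sum>p\<in>\<K>. card (fst p \<times> snd p))" by (rule card_UN_le[OF f\<K>])
  also have "\<dots> \<le> (\<Sum>p\<in>\<K>. g * h\<^sup>2 * card (B \<inter> seg (fst p) \<times> seg (snd p)))"
  proof (rule sum_mono)
    fix p assume "p \<in> \<K>"
    then obtain r c where p: "p = (cl r, cl' c)"
      and lt: "card (seg (cl r)) * card (seg (cl' c)) < g * card (B \<inter> seg (cl r) \<times> seg (cl' c))"
      by (auto simp: \<K>_def)
    have "card (fst p \<times> snd p) = card (cl r) * card (cl' c)" by (simp add: p card_cartesian_product)
    also have "\<dots> \<le> (h * card (seg (cl r))) * (h * card (seg (cl' c)))"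
      unfolding seg_def using fcl h by (intro mult_mono card_le_initial_segment) auto
    also have "\<dots> = h\<^sup>2 * (card (seg (cl r)) * card (seg (cl' c)))" by (simp add: power2_eq_square)
    also have "\<dots> \<le> h\<^sup>2 * (g * card (B \<inter> seg (cl r) \<times> seg (cl' c)))"
      using lt by (intro mult_left_mono) auto
    finally show "card (fst p \<times> snd p) \<le> g * h\<^sup>2 * card (B \<inter> seg (fst p) \<times> seg (snd p))"
      by (simp add: p mult_ac)
  qed
  also have "\<dots> = g * h\<^sup>2 * (\<Sum>p\<in>\<K>. card (B \<inter> seg (fst p) \<times> seg (snd p)))"
    by (simp add: sum_distrib_left)
  also have "(\<Sum>p\<in>\<K>. card (B \<inter> seg (fst p) \<times> seg (snd p))) =
      card (\<Union>p\<in>\<K>. B \<inter> seg (fst p) \<times> seg (snd p))"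
  proof (rule card_UN_disjoint[symmetric])
    show "\<forall>p\<in>\<K>. \<forall>q\<in>\<K>. p \<noteq> q \<longrightarrow>
        (B \<inter> seg (fst p) \<times> seg (snd p)) \<inter> (B \<inter> seg (fst q) \<times> seg (snd q)) = {}"
    proof (intro ballI impI)
      fix p q assume pq: "p \<in> \<K>" "q \<in> \<K>" "p \<noteq> q"
      show "(B \<inter> seg (fst p) \<times> seg (snd p)) \<inter> (B \<inter> seg (fst q) \<times> seg (snd q)) = {}"
      proof (rule ccontr)
        assume "(B \<inter> seg (fst p) \<times> seg (snd p)) \<inter> (B \<inter> seg (fst q) \<times> seg (snd q)) \<noteq> {}"
        then obtain x y where "x \<in> seg (fst p)" "x \<in> seg (fst q)" "y \<in> seg (snd p)" "y \<in> seg (snd q)"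
          by auto
        then have xy: "x \<in> fst p" "x \<in> fst q" "y \<in> snd p" "y \<in> snd q" using seg by blast+
        obtain r c r' c' where rc: "p = (cl r, cl' c)" "q = (cl r', cl' c')"
          using pq(1,2) by (auto simp: \<K>_def)
        have "cl r = cl r'" using cl(3)[of x r] cl(3)[of x r'] xy rc by simp
        moreover have "cl' c = cl' c'" using cl'(3)[of y c] cl'(3)[of y c'] xy rc by simp
        ultimately have "p = q" using rc by simp
        then show False using pq(3) by simp
      qed
    qed
  qed (use f\<K> B in auto)
  also have "\<dots> \<le> card B" using B by (intro card_mono) auto
  finally show ?thesis by simp
qed

text \<open>The entry at the two representatives would not do, since the row \<open>\<rho> r\<close>
  may be one where the column approximation is poor. Instead each row label \<open>a\<close> gets a
  row \<open>\<sigma> a\<close> of its class whose total error \<open>d + d'\<close> is at most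
  average. Passing from \<open>r\<close> to its representative, from there to
  \<open>\<sigma> (\<rho> r)\<close>, and from \<open>c\<close> to its representative costs at most
  \<open>3 * n\<^sup>2 / w\<close> each.\<close>

lemma exists_block_approximation:
  fixes M :: "nat \<Rightarrow> nat \<Rightarrow> bool"
  assumes r: "w * (\<Sum>r<n. row_dist n M r (\<rho> r)) \<le> 3 * n\<^sup>2"
    and c: "w * (\<Sum>c<n. row_dist n (\<lambda>c r. M r c) c (\<rho>' c)) \<le> 3 * n\<^sup>2"
  obtains f where "w * card {(r, c) \<in> {..<n} \<times> {..<n}. M r c \<noteq> f (\<rho> r) (\<rho>' c)} \<le> 9 * n\<^sup>2"
proof -
  define d where "d r = row_dist n M r (\<rho> r)" for r
  define d' where "d' r = card {c \<in> {..<n}. M r c \<noteq> M r (\<rho>' c)}" for r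
  define K where "K a = {r \<in> {..<n}. \<rho> r = a}" for a
  have "\<exists>v. v \<in> K a \<and> card (K a) * (d v + d' v) \<le> (\<Sum>x\<in>K a. d x + d' x)" if "a \<in> \<rho> ` {..<n}" for a
  proof -
    have "K a \<noteq> {}" "finite (K a)" using that by (auto simp: K_def)
    then show ?thesis using exists_le_average[of "K a" "\<lambda>v. d v + d' v"] by metis
  qed
  then obtain \<sigma> where \<sigma>: "\<And>a. a \<in> \<rho> ` {..<n} \<Longrightarrow> \<sigma> a \<in> K a"
      "\<And>a. a \<in> \<rho> ` {..<n} \<Longrightarrow> card (K a) * (d (\<sigma> a) + d' (\<sigma> a)) \<le> (\<Sum>x\<in>K a. d x + d' x)"
    by metis
  define f where "f a b = M (\<sigma> a) b" for a b
  have row: "card {c \<in> {..<n}. M r c \<noteq> f (\<rho> r) (\<rho>' c)} \<le> d r + (d (\<sigma> (\<rho> r)) + d' (\<sigma> (\<rho> r)))"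
    if r: "r < n" for r
  proof -
    let ?v = "\<sigma> (\<rho> r)"
    have "\<rho> ?v = \<rho> r" using \<sigma>(1)[of "\<rho> r"] r by (auto simp: K_def)
    then have "{c \<in> {..<n}. M r c \<noteq> f (\<rho> r) (\<rho>' c)} \<subseteq> {c \<in> {..<n}. M r c \<noteq> M (\<rho> r) c} \<union>
        ({c \<in> {..<n}. M ?v c \<noteq> M (\<rho> ?v) c} \<union> {c \<in> {..<n}. M ?v c \<noteq> M ?v (\<rho>' c)})"
      by (auto simp: f_def)
    then have "card {c \<in> {..<n}. M r c \<noteq> f (\<rho> r) (\<rho>' c)} \<le> card ({c \<in> {..<n}. M r c \<noteq> M (\<rho> r) c} \<union>
        ({c \<in> {..<n}. M ?v c \<noteq> M (\<rho> ?v) c} \<union> {c \<in> {..<n}. M ?v c \<noteq> M ?v (\<rho>' c)}))"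
      by (intro card_mono) auto
    also have "\<dots> \<le> d r + (d ?v + d' ?v)"
      unfolding d_def d'_def row_dist_def
      by (rule le_trans[OF card_Un_le]) (intro add_left_mono card_Un_le)
    finally show ?thesis .
  qed
  have "{(r, c) \<in> {..<n} \<times> {..<n}. M r c \<noteq> f (\<rho> r) (\<rho>' c)} =
      (SIGMA r:{..<n}. {c \<in> {..<n}. M r c \<noteq> f (\<rho> r) (\<rho>' c)})" by auto
  then have "card {(r, c) \<in> {..<n} \<times> {..<n}. M r c \<noteq> f (\<rho> r) (\<rho>' c)} =
      (\<Sum>r<n. card {c \<in> {..<n}. M r c \<noteq> f (\<rho> r) (\<rho>' c)})" by simp
  also have "\<dots> \<le> (\<Sum>r<n. d r + (d (\<sigma> (\<rho> r)) + d' (\<sigma> (\<rho> r))))" using row by (intro sum_mono) auto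
  also have "\<dots> = (\<Sum>r<n. d r) + (\<Sum>r<n. d (\<sigma> (\<rho> r)) + d' (\<sigma> (\<rho> r)))" by (rule sum.distrib)
  also have "(\<Sum>r<n. d (\<sigma> (\<rho> r)) + d' (\<sigma> (\<rho> r))) =
      (\<Sum>a\<in>\<rho> ` {..<n}. \<Sum>r\<in>K a. d (\<sigma> (\<rho> r)) + d' (\<sigma> (\<rho> r)))"
    unfolding K_def by (rule sum.image_gen) simp
  also have "\<dots> = (\<Sum>a\<in>\<rho> ` {..<n}. card (K a) * (d (\<sigma> a) + d' (\<sigma> a)))"
    by (rule sum.cong) (simp_all add: K_def)
  also have "\<dots> \<le> (\<Sum>a\<in>\<rho> ` {..<n}. \<Sum>x\<in>K a. d x + d' x)" using \<sigma>(2) by (rule sum_mono)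
  also have "\<dots> = (\<Sum>r<n. d r + d' r)" unfolding K_def by (rule sum.image_gen[symmetric]) simp
  also have "\<dots> = (\<Sum>r<n. d r) + (\<Sum>r<n. d' r)" by (rule sum.distrib)
  also have "(\<Sum>r<n. d' r) = (\<Sum>r<n. \<Sum>c<n. if M r c \<noteq> M r (\<rho>' c) then 1 else 0)"
    by (simp add: d'_def sum.If_cases Int_def)
  also have "\<dots> = (\<Sum>c<n. \<Sum>r<n. if M r c \<noteq> M r (\<rho>' c) then 1 else 0)" by (rule sum.swap)
  also have "\<dots> = (\<Sum>c<n. row_dist n (\<lambda>c r. M r c) c (\<rho>' c))"
    by (simp add: row_dist_def sum.If_cases Int_def)
  finally have "card {(r, c) \<in> {..<n} \<times> {..<n}. M r c \<noteq> f (\<rho> r) (\<rho>' c)} \<le>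
      (\<Sum>r<n. d r) + ((\<Sum>r<n. d r) + (\<Sum>c<n. row_dist n (\<lambda>c r. M r c) c (\<rho>' c)))"
    by simp
  then have "w * card {(r, c) \<in> {..<n} \<times> {..<n}. M r c \<noteq> f (\<rho> r) (\<rho>' c)} \<le>
      w * ((\<Sum>r<n. d r) + ((\<Sum>r<n. d r) + (\<Sum>c<n. row_dist n (\<lambda>c r. M r c) c (\<rho>' c))))"
    by (rule mult_le_mono2)
  also have "\<dots> \<le> 9 * n\<^sup>2" using r c by (simp add: d_def distrib_left)
  finally show ?thesis using that by blast
qed

lemma card_copies_transpose:
  "card (copies t s (\<lambda>j i. A i j) n (\<lambda>c r. M r c)) = card (copies s t A n M)"
proof (rule bij_betw_same_card[where f = prod.swap])
  show "bij_betw prod.swap (copies t s (\<lambda>j i. A i j) n (\<lambda>c r. M r c)) (copies s t A n M)"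
    by (rule bij_betw_byWitness[where f' = prod.swap]) (auto simp: copies_def is_copy_iff_rank)
qed

text \<open>All losses are measured against at least \<open>n\<^sup>2 / w\<close> disjoint copies.
  The constant in \<open>h\<close> allows \<open>n\<^sup>2 / (8 * w)\<close> positions for the
  removed rows and as many for the removed columns; the constant 12 allows
  \<open>n\<^sup>2 / (4 * w)\<close> for bad entries and bad blocks together. So at most half of the
  copies are hit.\<close>

lemma many_copies_of_block_approximation:
  fixes M :: "nat \<Rightarrow> nat \<Rightarrow> bool" and lab lab' :: "nat \<Rightarrow> nat" and w T n s t :: nat
  defines "h \<equiv> 24 * (s + t) * w"
  defines "Q \<equiv> (T + 1) ^ (s + t)"
  assumes s: "s \<ge> 1" and t: "t \<ge> 1" and w: "w \<ge> 1"
    and T: "card (lab ` {..<n}) \<le> T" "card (lab' ` {..<n}) \<le> T"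
    and f: "12 * s\<^sup>2 * t\<^sup>2 * h\<^sup>2 * w * card {(r, c) \<in> {..<n} \<times> {..<n}. M r c \<noteq> f (lab r) (lab' c)} \<le> n\<^sup>2"
    and n: "h\<^sup>2 * Q \<le> n"
    and S: "S \<subseteq> copies s t A n M" "pairwise_disjoint_copies S" "n\<^sup>2 \<le> w * card S"
  shows "n ^ (s + t) \<le> 2 * (h\<^sup>2 * Q) ^ (s + t) * card (copies s t A n M)"
proof -
  have h: "h \<ge> 1" using s w by (simp add: h_def)
  have Q: "Q \<ge> 1" by (simp add: Q_def)
  have npos: "n > 0" using n h Q by (cases n) auto
  let ?seg = "initial_segment h"
  define Bad where "Bad = {(r, c) \<in> {..<n} \<times> {..<n}. M r c \<noteq> f (lab r) (lab' c)}"
  have fBad: "finite Bad" unfolding Bad_def by (rule finite_subset[of _ "{..<n} \<times> {..<n}"]) auto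
  obtain Z cl where R: "nested_cells n lab h Q (s + t) Z cl"
    using exists_nested_cells[OF T(1) h n[unfolded Q_def]] unfolding Q_def by blast
  obtain Z' cl' where C: "nested_cells n lab' h Q (s + t) Z' cl'"
    using exists_nested_cells[OF T(2) h n[unfolded Q_def]] unfolding Q_def by blast
  interpret R: nested_cells n lab h Q "s + t" Z cl by (rule R)
  interpret C: nested_cells n lab' h Q "s + t" Z' cl' by (rule C)
  have fcl: "finite (cl k c)" "finite (cl' k c)" for k c
    using finite_subset[OF R.cl_subset] finite_subset[OF C.cl_subset] by simp_all
  \<comment> \<open>The threshold \<open>2 * s * t\<close> is that of the union bound over
    transversals; levels \<open>i\<close> and \<open>j\<close> are paired because row
    \<open>i\<close> of the copy will use level \<open>i\<close> and column \<open>j\<close> level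
    \<open>j\<close>.\<close>
  define BB where "BB i j = {(r, c) \<in> {..<n} \<times> {..<n}.
      card (?seg (cl i r)) * card (?seg (cl' j c)) < 2 * s * t * card (Bad \<inter> ?seg (cl i r) \<times> ?seg (cl' j c))}" for i j
  have fBB: "finite (BB i j)" for i j
    unfolding BB_def by (rule finite_subset[of _ "{..<n} \<times> {..<n}"]) auto
  have BB: "card (BB i j) \<le> 2 * s * t * h\<^sup>2 * card Bad" for i j
    unfolding BB_def by (intro card_bad_blocks_le[OF h fBad]
        R.cl_subset R.mem_cl R.cl_eq C.cl_subset C.mem_cl C.cl_eq)
  define U where "U = (\<Union>i<s. \<Union>j<t. BB i j)"
  define Kill where "Kill = Z \<times> {..<n} \<union> {..<n} \<times> Z' \<union> (Bad \<union> U)"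
  have fin: "finite Z" "finite Z'" "finite U" using finite_subset[OF R.removed_subset] finite_subset[OF C.removed_subset] fBB
    by (simp_all add: U_def)
  have fKill: "finite Kill" using fin fBad by (simp add: Kill_def)
  have "card U \<le> (\<Sum>i<s. card (\<Union>j<t. BB i j))" unfolding U_def by (rule card_UN_le) simp
  also have "\<dots> \<le> (\<Sum>i<s. \<Sum>j<t. card (BB i j))" by (intro sum_mono card_UN_le) simp
  also have "\<dots> \<le> (\<Sum>i<s. \<Sum>j<t. 2 * s * t * h\<^sup>2 * card Bad)" by (intro sum_mono BB)
  also have "\<dots> = 2 * (s\<^sup>2 * t\<^sup>2 * h\<^sup>2) * card Bad" by (simp add: power2_eq_square)
  finally have U: "card U \<le> 2 * (s\<^sup>2 * t\<^sup>2 * h\<^sup>2) * card Bad" .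
  have "1 \<le> s\<^sup>2 * t\<^sup>2 * h\<^sup>2" using s t h by simp
  then have "1 * card Bad \<le> (s\<^sup>2 * t\<^sup>2 * h\<^sup>2) * card Bad" by (rule mult_right_mono) simp
  \<comment> \<open>The bad blocks contribute 2 and the bad entries 1 to the factor 3; times 4 this
    is the 12 in the hypothesis on \<open>f\<close>.\<close>
  then have "card Bad + card U \<le> 3 * (s\<^sup>2 * t\<^sup>2 * h\<^sup>2) * card Bad" using U by linarith
  then have "4 * w * (card Bad + card U) \<le> 4 * w * (3 * (s\<^sup>2 * t\<^sup>2 * h\<^sup>2) * card Bad)"
    by (rule mult_le_mono2)
  also have "\<dots> = 12 * s\<^sup>2 * t\<^sup>2 * h\<^sup>2 * w * card Bad" by simp
  also have "\<dots> \<le> n\<^sup>2" using f by (simp add: Bad_def)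
  finally have 1: "4 * w * (card Bad + card U) \<le> n\<^sup>2" .
  have Zn: "8 * w * (card X * n) \<le> n\<^sup>2" if "h * card X \<le> 3 * (s + t) * n" for X :: "nat set"
  proof -
    have "3 * (s + t) * (8 * w * card X) = h * card X" by (simp add: h_def)
    also have "\<dots> \<le> 3 * (s + t) * n" by (rule that)
    finally have "8 * w * card X \<le> n" using s by simp
    then have "8 * w * card X * n \<le> n * n" by (rule mult_le_mono1)
    then show ?thesis by (simp add: power2_eq_square mult.assoc)
  qed
  have "card Kill \<le> card (Z \<times> {..<n} \<union> {..<n} \<times> Z') + card (Bad \<union> U)"
    unfolding Kill_def by (rule card_Un_le)
  also have "\<dots> \<le> card (Z \<times> {..<n}) + card ({..<n} \<times> Z') + (card Bad + card U)"
    by (intro add_mono card_Un_le)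
  also have "\<dots> = card Z * n + card Z' * n + (card Bad + card U)"
    by (simp add: card_cartesian_product)
  finally have "8 * w * card Kill \<le> 8 * w * (card Z * n + card Z' * n + (card Bad + card U))"
    by (rule mult_le_mono2)
  also have "\<dots> = 8 * w * (card Z * n) + 8 * w * (card Z' * n) + 2 * (4 * w * (card Bad + card U))"
    by (simp add: algebra_simps)
  also have "\<dots> \<le> 4 * n\<^sup>2" using Zn[OF R.card_removed] Zn[OF C.card_removed] 1 by linarith
  finally have "8 * (w * card Kill) \<le> 4 * n\<^sup>2" by (simp only: mult.assoc)
  moreover have "n\<^sup>2 > 0" using npos by simp
  ultimately have "w * card Kill < n\<^sup>2" by linarith
  also have "n\<^sup>2 \<le> w * card S" by (rule S(3))
  finally have "card Kill < card S" by simp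
  then obtain R C where RC: "(R, C) \<in> S" "(R \<times> C) \<inter> Kill = {}"
    using exists_copy_avoiding[OF S(1,2) fKill] unfolding positions_def by (metis fst_conv snd_conv surj_pair)
  define r where "r i = sorted_list_of_set R ! i" for i
  define c where "c j = sorted_list_of_set C ! j" for j
  have copy: "R \<subseteq> {..<n}" "C \<subseteq> {..<n}" "card R = s" "card C = t"
    "\<And>i j. i < s \<Longrightarrow> j < t \<Longrightarrow> M (r i) (c j) = A i j"
    using RC(1) S(1) by (auto simp: copies_def is_copy_def r_def c_def)
  have finRC: "finite R" "finite C" using copy by (auto intro: finite_subset)
  have rR: "r i \<in> R" if "i < s" for i
    using that finRC copy nth_mem[of i "sorted_list_of_set R"] by (simp add: r_def)
  have cC: "c j \<in> C" if "j < t" for j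
    using that finRC copy nth_mem[of j "sorted_list_of_set C"] by (simp add: c_def)
  have rless: "r i < r i'" if "i < i'" "i' < s" for i i'
    unfolding r_def using that copy finRC
    by (intro sorted_wrt_nth_less[OF strict_sorted_list_of_set]) auto
  have cless: "c j < c j'" if "j < j'" "j' < t" for j j'
    unfolding c_def using that copy finRC
    by (intro sorted_wrt_nth_less[OF strict_sorted_list_of_set]) auto
  have nk: "(r i, c j) \<notin> Kill" if "i < s" "j < t" for i j
    using RC(2) rR[OF that(1)] cC[OF that(2)] by blast
  have rZ: "r i \<in> {..<n} - Z" if i: "i < s" for i
    using nk[OF i, of 0] rR[OF i] cC[of 0] copy(1,2) t by (auto simp: Kill_def)
  have cZ: "c j \<in> {..<n} - Z'" if j: "j < t" for j
    using nk[of 0 j] rR[of 0] cC[OF j] copy(1,2) s j by (auto simp: Kill_def)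
  define D where "D i = ?seg (cl i (r i))" for i
  define E where "E j = ?seg (cl' j (c j))" for j
  have Dsub: "D i \<subseteq> cl i (r i)" "E j \<subseteq> cl' j (c j)" for i j
    by (simp_all add: D_def E_def initial_segment_subset)
  have prods: "(\<Prod>i<s. card (D i)) * (\<Prod>j<t. card (E j)) \<le> 2 * card (copies s t A n M)"
  proof (rule card_copies_ge_of_blocks[OF s t, where B = Bad])
    show "D i \<subseteq> {..<n}" for i using Dsub(1) R.cl_subset by (rule order_trans)
    show "E j \<subseteq> {..<n}" for j using Dsub(2) C.cl_subset by (rule order_trans)
  next
    fix i i' x x' assume a: "i < i'" "i' < s" "x \<in> D i" "x' \<in> D i'"
    show "x < x'"
    proof (rule R.segments_ordered)
      show "r i \<in> {..<n} - Z" using a by (intro rZ) simp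
      show "x \<in> ?seg (cl i (r i))" using a by (simp add: D_def)
      show "x' \<in> cl i' (r i')" using a Dsub by blast
    qed (use a rless in auto)
  next
    fix j j' y y' assume a: "j < j'" "j' < t" "y \<in> E j" "y' \<in> E j'"
    show "y < y'"
    proof (rule C.segments_ordered)
      show "c j \<in> {..<n} - Z'" using a by (intro cZ) simp
      show "y \<in> ?seg (cl' j (c j))" using a by (simp add: E_def)
      show "y' \<in> cl' j' (c j')" using a Dsub by blast
    qed (use a cless in auto)
  next
    fix i j assume ij: "i < s" "j < t"
    then have "(r i, c j) \<notin> BB i j" using nk[OF ij] by (auto simp: Kill_def U_def)
    then show "2 * s * t * card (Bad \<inter> D i \<times> E j) \<le> card (D i) * card (E j)"
      using rZ[OF ij(1)] cZ[OF ij(2)] by (simp add: BB_def D_def E_def not_less)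
  next
    fix i j x y assume a: "i < s" "j < t" "x \<in> D i" "y \<in> E j" "(x, y) \<notin> Bad"
    have x: "x \<in> cl i (r i)" "y \<in> cl' j (c j)" using a Dsub by blast+
    then have xn: "x < n" "y < n" using R.cl_subset C.cl_subset by blast+
    \<comment> \<open>Neither \<open>(x, y)\<close> nor \<open>(r i, c j)\<close> is in
      \<open>Bad\<close>, the latter because \<open>Kill\<close> contains \<open>Bad\<close>; so
      both entries equal the value of \<open>f\<close> at the common labels.\<close>
    have "M x y = f (lab x) (lab' y)" using a(5) xn by (simp add: Bad_def)
    also have "\<dots> = f (lab (r i)) (lab' (c j))" using R.lab_eq[OF x(1)] C.lab_eq[OF x(2)] by simp
    also have "\<dots> = M (r i) (c j)" using nk[OF a(1,2)] rZ[OF a(1)] cZ[OF a(2)] by (auto simp: Kill_def Bad_def)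
    also have "\<dots> = A i j" using copy(5) a by simp
    finally show "M x y = A i j" .
  qed
  \<comment> \<open>Through \<open>Q\<close>, this is where the number of labels enters the
    density.\<close>
  have seg: "n \<le> (h\<^sup>2 * Q) * card (?seg K)" if "n \<le> card K * (h * Q)" "finite K" for K
  proof -
    have "n \<le> card K * (h * Q)" by (rule that(1))
    also have "\<dots> \<le> h * card (?seg K) * (h * Q)"
      using card_le_initial_segment[OF that(2) h] by (rule mult_le_mono1)
    also have "\<dots> = (h\<^sup>2 * Q) * card (?seg K)" by (simp add: power2_eq_square)
    finally show ?thesis .
  qed
  have nD: "n \<le> (h\<^sup>2 * Q) * card (D i)" if "i < s" for i
    unfolding D_def using that by (intro seg fcl R.cl_large rZ) simp_all
  have nE: "n \<le> (h\<^sup>2 * Q) * card (E j)" if "j < t" for j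
    unfolding E_def
    using that by (intro seg fcl C.cl_large cZ) simp_all
  have "n ^ (s + t) = (\<Prod>i<s. n) * (\<Prod>j<t. n)" by (simp add: power_add)
  also have "\<dots> \<le> (\<Prod>i<s. (h\<^sup>2 * Q) * card (D i)) * (\<Prod>j<t. (h\<^sup>2 * Q) * card (E j))"
    using nD nE by (intro mult_mono prod_mono) auto
  also have "\<dots> = (h\<^sup>2 * Q) ^ (s + t) * ((\<Prod>i<s. card (D i)) * (\<Prod>j<t. card (E j)))"
    by (simp only: prod.distrib prod_constant card_lessThan power_add power_mult_distrib mult_ac)
  also have "\<dots> \<le> (h\<^sup>2 * Q) ^ (s + t) * (2 * card (copies s t A n M))"
    using prods by (rule mult_le_mono2)
  finally show ?thesis by (simp only: mult_ac)
qed

text \<open>Row and column labels are taken at accuracy \<open>9 * W w\<close>, since combining them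
  costs a factor 9 and accuracy \<open>W w\<close> must remain. \<open>F\<close> bounds the loss in
  all cases: its summand \<open>T\<close> covers the failure of clustering for rows or columns, the
  summand with \<open>n0\<close> covers the copies found in blocks and the small values of
  \<open>n\<close>.\<close>

lemma polynomial_removal_nat:
  assumes s: "s \<ge> 1" and t: "t \<ge> 1"
  shows "\<exists>C N. \<forall>w\<ge>1. \<forall>n M S. S \<subseteq> copies s t A n M \<longrightarrow> pairwise_disjoint_copies S \<longrightarrow>
    n\<^sup>2 \<le> w * card S \<longrightarrow> n ^ (s + t) \<le> C * w ^ N * card (copies s t A n M)"
proof -
  obtain C1 N1 where rows: "\<forall>w\<ge>1. \<forall>n M. C1 * w ^ N1 * card (copies s t A n M) < n ^ (s + t) \<longrightarrow>
    (\<exists>\<rho>. \<rho> ` {..<n} \<subseteq> {..<n} \<and> card (\<rho> ` {..<n}) \<le> C1 * w ^ N1 \<and>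
      w * (\<Sum>r<n. row_dist n M r (\<rho> r)) \<le> 3 * n\<^sup>2)"
    using row_clusters_or_many_copies[OF s, of t A] by (elim exE)
  obtain C2 N2 where cols: "\<forall>w\<ge>1. \<forall>n M.
    C2 * w ^ N2 * card (copies t s (\<lambda>j i. A i j) n M) < n ^ (t + s) \<longrightarrow>
    (\<exists>\<rho>. \<rho> ` {..<n} \<subseteq> {..<n} \<and> card (\<rho> ` {..<n}) \<le> C2 * w ^ N2 \<and>
      w * (\<Sum>r<n. row_dist n M r (\<rho> r)) \<le> 3 * n\<^sup>2)"
    using row_clusters_or_many_copies[OF t, of s "\<lambda>j i. A i j"] by (elim exE)
  define h where "h w = 24 * (s + t) * w" for w :: nat
  define W where "W w = 12 * s\<^sup>2 * t\<^sup>2 * (h w)\<^sup>2 * w" for w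
  define T where "T w = C1 * (9 * W w) ^ N1 + C2 * (9 * W w) ^ N2" for w
  define n0 where "n0 w = (h w)\<^sup>2 * (T w + 1) ^ (s + t)" for w
  define F where "F w = T w + 2 * n0 w ^ (s + t)" for w
  have "poly_bounded F"
    unfolding F_def n0_def T_def W_def h_def by (intro poly_bounded_intros)
  then obtain C N where CN: "\<And>w. w \<ge> 1 \<Longrightarrow> F w \<le> C * w ^ N"
    unfolding poly_bounded_def by blast
  have "n ^ (s + t) \<le> C * w ^ N * card (copies s t A n M)"
    if w: "w \<ge> 1" and S: "S \<subseteq> copies s t A n M" "pairwise_disjoint_copies S" "n\<^sup>2 \<le> w * card S"
    for w n M S
  proof -
    have "n ^ (s + t) \<le> F w * card (copies s t A n M)"
    proof (rule ccontr)
      assume "\<not> n ^ (s + t) \<le> F w * card (copies s t A n M)"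
      then have few: "F w * card (copies s t A n M) < n ^ (s + t)" by simp
      have lt: "b * card (copies s t A n M) < n ^ (s + t)" if "b \<le> F w" for b
        using mult_le_mono1[OF that] few by (rule le_less_trans)
      have W: "9 * W w \<ge> 1" using s t w by (simp add: W_def h_def)
      have "C1 * (9 * W w) ^ N1 * card (copies s t A n M) < n ^ (s + t)"
        by (rule lt) (simp add: F_def T_def)
      then obtain \<rho> where \<rho>: "card (\<rho> ` {..<n}) \<le> C1 * (9 * W w) ^ N1"
          "9 * W w * (\<Sum>r<n. row_dist n M r (\<rho> r)) \<le> 3 * n\<^sup>2"
        using rows[rule_format, OF W] by blast
      have "C2 * (9 * W w) ^ N2 * card (copies t s (\<lambda>j i. A i j) n (\<lambda>c r. M r c)) < n ^ (t + s)"
        unfolding card_copies_transpose[of t s A n M] add.commute[of t s]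
        by (rule lt) (simp add: F_def T_def)
      then obtain \<rho>' where \<rho>': "card (\<rho>' ` {..<n}) \<le> C2 * (9 * W w) ^ N2"
          "9 * W w * (\<Sum>c<n. row_dist n (\<lambda>c r. M r c) c (\<rho>' c)) \<le> 3 * n\<^sup>2"
        using cols[rule_format, OF W] by blast
      obtain f where "9 * W w * card {(r, c) \<in> {..<n} \<times> {..<n}. M r c \<noteq> f (\<rho> r) (\<rho>' c)} \<le> 9 * n\<^sup>2"
        by (rule exists_block_approximation[OF \<rho>(2) \<rho>'(2)])
      then have f: "W w * card {(r, c) \<in> {..<n} \<times> {..<n}. M r c \<noteq> f (\<rho> r) (\<rho>' c)} \<le> n\<^sup>2" by simp
      have npos: "n > 0" using few s by (cases n) (auto simp: power_0_left)
      show False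
      proof (cases "n0 w \<le> n")
        case True
        have "n ^ (s + t) \<le> 2 * ((h w)\<^sup>2 * (T w + 1) ^ (s + t)) ^ (s + t) * card (copies s t A n M)"
          unfolding h_def
        proof (rule many_copies_of_block_approximation[OF s t w,
              where lab = \<rho> and lab' = \<rho>' and f = f and S = S])
          show "card (\<rho> ` {..<n}) \<le> T w" using \<rho>(1) by (simp add: T_def)
          show "card (\<rho>' ` {..<n}) \<le> T w" using \<rho>'(1) by (simp add: T_def)
          show "12 * s\<^sup>2 * t\<^sup>2 * (24 * (s + t) * w)\<^sup>2 * w *
              card {(r, c) \<in> {..<n} \<times> {..<n}. M r c \<noteq> f (\<rho> r) (\<rho>' c)} \<le> n\<^sup>2"
            using f unfolding W_def h_def .
          show "(24 * (s + t) * w)\<^sup>2 * (T w + 1) ^ (s + t) \<le> n" using True unfolding n0_def h_def .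
        qed (fact S)+
        moreover have "2 * n0 w ^ (s + t) * card (copies s t A n M) < n ^ (s + t)"
          by (rule lt) (simp add: F_def)
        ultimately show False unfolding n0_def by simp
      next
        case False
        \<comment> \<open>For \<open>n\<close> below \<open>n0 w\<close> a single copy suffices,
          because \<open>n ^ (s + t)\<close> is at most \<open>n0 w ^ (s + t)\<close>.\<close>
        have "card S > 0" using S(3) npos by (cases "card S") auto
        then have "1 \<le> card (copies s t A n M)"
          using card_mono[OF finite_copies S(1)] by simp
        then have "n0 w ^ (s + t) * 1 \<le> n0 w ^ (s + t) * card (copies s t A n M)" by (rule mult_le_mono2)
        also have "\<dots> < n ^ (s + t)" by (rule lt) (simp add: F_def)
        also have "\<dots> \<le> n0 w ^ (s + t)" using False by (intro power_mono) auto
        finally show False by simp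
      qed
    qed
    also have "\<dots> \<le> C * w ^ N * card (copies s t A n M)" using CN[OF w] by (rule mult_le_mono1)
    finally show ?thesis .
  qed
  then show ?thesis by (intro exI[of _ C] exI[of _ N] allI impI)
qed

section \<open>From natural parameters to real ones\<close>

theorem theorem1p2:
  fixes s t :: nat and A :: "nat \<Rightarrow> nat \<Rightarrow> bool"
  assumes "s \<ge> 1" and "t \<ge> 1"
  shows "\<exists>p :: real poly.
           (\<forall>\<epsilon>::real. \<epsilon> > 0 \<longrightarrow> poly p (1 / \<epsilon>) > 0) \<and>
           (\<forall>\<epsilon>::real. \<epsilon> > 0 \<longrightarrow>
              (\<forall>(n::nat) (M :: nat \<Rightarrow> nat \<Rightarrow> bool) S.
                 S \<subseteq> copies s t A n M \<and> pairwise_disjoint_copies S \<and>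
                 real (card S) \<ge> \<epsilon> * real n ^ 2
                 \<longrightarrow> real (card (copies s t A n M))
                       \<ge> (1 / poly p (1 / \<epsilon>)) * real n ^ (s + t)))"
proof -
  obtain C N where CN: "\<forall>w\<ge>1. \<forall>n M S. S \<subseteq> copies s t A n M \<longrightarrow> pairwise_disjoint_copies S \<longrightarrow>
    n\<^sup>2 \<le> w * card S \<longrightarrow> n ^ (s + t) \<le> C * w ^ N * card (copies s t A n M)"
    using polynomial_removal_nat[OF assms, of A] by (elim exE)
  \<comment> \<open>\<open>w\<close> will be \<open>1 / \<epsilon>\<close> rounded up, so it is at
    most \<open>1 + 1 / \<epsilon>\<close>; hence the base \<open>1 + x\<close>. Adding 1 to
    \<open>C\<close> keeps the polynomial positive even for \<open>C = 0\<close>.\<close>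
  define p :: "real poly" where "p = smult (real C + 1) ([:1, 1:] ^ N)"
  have p: "poly p x = (real C + 1) * (1 + x) ^ N" for x by (simp add: p_def poly_power)
  have pos: "poly p (1 / \<epsilon>) > 0" if "\<epsilon> > 0" for \<epsilon> :: real
    unfolding p using that by (intro mult_pos_pos zero_less_power) (auto intro: add_pos_pos)
  have main: "real (card (copies s t A n M)) \<ge> (1 / poly p (1 / \<epsilon>)) * real n ^ (s + t)"
    if \<epsilon>: "\<epsilon> > 0" and S: "S \<subseteq> copies s t A n M" "pairwise_disjoint_copies S"
      "real (card S) \<ge> \<epsilon> * real n ^ 2" for \<epsilon> :: real and n M S
  proof -
    define w where "w = nat \<lceil>1 / \<epsilon>\<rceil>"
    have w: "1 / \<epsilon> \<le> real w" "real w \<le> 1 + 1 / \<epsilon>"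
      unfolding w_def using \<epsilon> of_int_ceiling_le_add_one[of "1 / \<epsilon>"]
      by (simp_all add: add.commute real_nat_ceiling_ge)
    have "real w > 0" using w(1) \<epsilon> by (meson divide_pos_pos less_le_trans zero_less_one)
    then have w1: "w \<ge> 1" by simp
    have "real n ^ 2 \<le> (1 / \<epsilon>) * real (card S)" using S(3) \<epsilon> by (simp add: field_simps)
    also have "\<dots> \<le> real w * real (card S)" using w(1) by (intro mult_right_mono) auto
    finally have "real (n\<^sup>2) \<le> real (w * card S)" by simp
    then have "n\<^sup>2 \<le> w * card S" by (simp only: of_nat_le_iff)
    from CN[rule_format, OF w1 S(1,2) this]
    have "real (n ^ (s + t)) \<le> real (C * w ^ N * card (copies s t A n M))" by (simp only: of_nat_le_iff)
    then have "real n ^ (s + t) \<le> real C * real w ^ N * real (card (copies s t A n M))" by simp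
    also have "\<dots> \<le> poly p (1 / \<epsilon>) * real (card (copies s t A n M))"
      unfolding p using w(2) by (intro mult_right_mono mult_mono power_mono) auto
    finally show ?thesis using pos[OF \<epsilon>] by (simp add: field_simps)
  qed
  show ?thesis
    by (intro exI[of _ p] conjI allI impI) (erule pos, elim conjE, rule main)
qed

end
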